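(* The family of minimal subshifts $(X,G)$ which are almost 1-1 extensions of subodometers coincides with the family of $G$-Toeplitz systems. That is, for a finite alphabet $\Sigma$ and a subshift $X\subseteq\Sigma^G$, the system $(X,G)$ is minimal and is an almost 1-1 extension of some subodometer if and only if there is a $G$-Toeplitz array $x\in\Sigma^G$ such that $X$ is the closure of the $G$-orbit of $x$.
   Context: $G$ is a discrete finitely generated group with neutral element $e$. A topological dynamical system $(X,G)$ is a compact metric space $X$ with an action of $G$ by homeomorphisms. It is minimal if every $G$-orbit is dense. A factor map $\pi:(X,G)\to(Y,G)$ is a continuous surjection commuting with the actions; $(X,G)$ is an almost 1-1 extension of $(Y,G)$ if there is a factor map $\pi:X\to Y$ such that the set of points of $Y$ having exactly one pre-image contains a dense $G_\delta$ subset of $Y$. Subodometers: let $\Gamma_0\supseteq\Gamma_1\supseteq\cdots$ be a decreasing sequence of finite-index subgroups of $G$ (it is not required that $\bigcap_i\Gamma_i=\{e\}$), $G/\Gamma_i=\{g\Gamma_i\}$ discrete, and $\pi_i:G/\Gamma_{i+1}\to G/\Gamma_i$ the map induced by inclusion. The inverse limit $\overleftarrow{G}=\lim_{\leftarrow i}(G/\Gamma_i,\pi_i)$ with the product topology and the action of $G$ by left multiplication on each coordinate is called a subodometer. For a finite alphabet $\Sigma$, $\Sigma^G$ carries the product topology and the shift action $(\gamma.x)(g)=x(g\gamma)$ for $\gamma,g\in G$. A subshift is a closed $G$-invariant subset $X\subseteq\Sigma^G$ with the restricted action. For a syndetic (i.e. finite-index) subgroup $\Gamma\subseteq G$ and $x\in\Sigma^G$,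 $Per(x,\Gamma,\sigma)=\{g\in G: x(g\gamma)=\sigma\ \text{for all }\gamma\in\Gamma\}$ for $\sigma\in\Sigma$, and $Per(x,\Gamma)=\bigcup_{\sigma\in\Sigma}Per(x,\Gamma,\sigma)$. The element $x$ is a $G$-Toeplitz array if for every $g\in G$ there is a syndetic subgroup $\Gamma$ of $G$ with $g\in Per(x,\Gamma)$. A $G$-Toeplitz system is a subshift that is the $G$-orbit closure of a $G$-Toeplitz array. *)

theory Defs
  imports
    "HOL-Algebra.Group_Action"
    "HOL-Algebra.Left_Coset"
    "HOL-Algebra.Generated_Groups"
    "HOL-Analysis.Analysis"
begin

definition finitely_generated :: "('g, 'm) monoid_scheme \<Rightarrow> bool" where
  "finitely_generated G \<longleftrightarrow> (\<exists>S. finite S \<and> S \<subseteq> carrier G \<and> generate G S = carrier G)"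

text \<open>In a discrete group, a subgroup is syndetic iff it has finite index.\<close>

definition syndetic_subgroup :: "('g, 'm) monoid_scheme \<Rightarrow> 'g set \<Rightarrow> bool" where
  "syndetic_subgroup G \<Gamma> \<longleftrightarrow> subgroup \<Gamma> G \<and> finite (lcosets\<^bsub>G\<^esub> \<Gamma>)"


section \<open>Topological dynamical systems\<close>

text \<open>The phase space is a compact metrizable topology \<open>T\<close> on a subset of a type; the action
  is a homomorphism from \<open>G\<close> to the permutations of that subset.\<close>

definition dynamical_system ::
    "('g, 'm) monoid_scheme \<Rightarrow> 'x topology \<Rightarrow> ('g \<Rightarrow> 'x \<Rightarrow> 'x) \<Rightarrow> bool" where
  "dynamical_system G T \<phi> \<longleftrightarrow>
     compact_space T \<and> metrizable_space T \<and>
     group_action G (topspace T) \<phi> \<and> (\<forall>g\<in>carrier G. homeomorphic_map T T (\<phi> g))"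

definition minimal_system ::
    "('g, 'm) monoid_scheme \<Rightarrow> 'x topology \<Rightarrow> ('g \<Rightarrow> 'x \<Rightarrow> 'x) \<Rightarrow> bool" where
  "minimal_system G T \<phi> \<longleftrightarrow>
     dynamical_system G T \<phi> \<and>
     (\<forall>x\<in>topspace T. T closure_of (orbit G \<phi> x) = topspace T)"

definition factor_map ::
    "('g, 'm) monoid_scheme \<Rightarrow> 'x topology \<Rightarrow> ('g \<Rightarrow> 'x \<Rightarrow> 'x) \<Rightarrow>
     'y topology \<Rightarrow> ('g \<Rightarrow> 'y \<Rightarrow> 'y) \<Rightarrow> ('x \<Rightarrow> 'y) \<Rightarrow> bool" where
  "factor_map G S \<phi> T \<psi> \<pi> \<longleftrightarrow>
     dynamical_system G S \<phi> \<and> dynamical_system G T \<psi> \<and>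
     continuous_map S T \<pi> \<and> \<pi> ` topspace S = topspace T \<and>
     (\<forall>g\<in>carrier G. \<forall>x\<in>topspace S. \<pi> (\<phi> g x) = \<psi> g (\<pi> x))"

definition almost_1_1_extension ::
    "('g, 'm) monoid_scheme \<Rightarrow> 'x topology \<Rightarrow> ('g \<Rightarrow> 'x \<Rightarrow> 'x) \<Rightarrow>
     'y topology \<Rightarrow> ('g \<Rightarrow> 'y \<Rightarrow> 'y) \<Rightarrow> bool" where
  "almost_1_1_extension G S \<phi> T \<psi> \<longleftrightarrow>
     (\<exists>\<pi>. factor_map G S \<phi> T \<psi> \<pi> \<and>
       (\<exists>D. gdelta_in T D \<and> T closure_of D = topspace T \<and>
         D \<subseteq> {y \<in> topspace T. \<exists>!x. x \<in> topspace S \<and> \<pi> x = y}))"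


section \<open>Subodometers\<close>

definition subodometer_sequence :: "('g, 'm) monoid_scheme \<Rightarrow> (nat \<Rightarrow> 'g set) \<Rightarrow> bool" where
  "subodometer_sequence G \<Gamma> \<longleftrightarrow>
     (\<forall>i. syndetic_subgroup G (\<Gamma> i)) \<and> (\<forall>i. \<Gamma> (Suc i) \<subseteq> \<Gamma> i)"

text \<open>The map \<open>G/\<Gamma>\<^sub>i\<^sub>+\<^sub>1 \<rightarrow> G/\<Gamma>\<^sub>i\<close> induced by inclusion sends a coset \<open>C\<close> to the product set
  \<open>C \<Gamma>\<^sub>i\<close>; see \<open>coset_projection_l_coset\<close> below.\<close>

definition coset_projection ::
    "('g, 'm) monoid_scheme \<Rightarrow> (nat \<Rightarrow> 'g set) \<Rightarrow> nat \<Rightarrow> 'g set \<Rightarrow> 'g set" where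
  "coset_projection G \<Gamma> i C = C <#>\<^bsub>G\<^esub> \<Gamma> i"

lemma coset_projection_l_coset:
  assumes "group G" "subodometer_sequence G \<Gamma>" "g \<in> carrier G"
  shows "coset_projection G \<Gamma> i (g <#\<^bsub>G\<^esub> \<Gamma> (Suc i)) = g <#\<^bsub>G\<^esub> \<Gamma> i"
proof -
  interpret group G by fact
  have s: "subgroup (\<Gamma> i) G" "subgroup (\<Gamma> (Suc i)) G" "\<Gamma> (Suc i) \<subseteq> \<Gamma> i"
    using assms(2) by (auto simp: subodometer_sequence_def syndetic_subgroup_def)
  have "\<Gamma> (Suc i) <#>\<^bsub>G\<^esub> \<Gamma> i = \<Gamma> i"
  proof
    show "\<Gamma> (Suc i) <#>\<^bsub>G\<^esub> \<Gamma> i \<subseteq> \<Gamma> i"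
      using s by (auto simp: set_mult_def subgroup.m_closed)
    show "\<Gamma> i \<subseteq> \<Gamma> (Suc i) <#>\<^bsub>G\<^esub> \<Gamma> i"
    proof
      fix h assume h: "h \<in> \<Gamma> i"
      then have "\<one>\<^bsub>G\<^esub> \<otimes>\<^bsub>G\<^esub> h = h" using s(1) subgroup.mem_carrier by fastforce
      then show "h \<in> \<Gamma> (Suc i) <#>\<^bsub>G\<^esub> \<Gamma> i"
        using h subgroup.one_closed[OF s(2)] unfolding set_mult_def by force
    qed
  qed
  moreover have "(g <#\<^bsub>G\<^esub> \<Gamma> (Suc i)) <#>\<^bsub>G\<^esub> \<Gamma> i = g <#\<^bsub>G\<^esub> (\<Gamma> (Suc i) <#>\<^bsub>G\<^esub> \<Gamma> i)"
    using s assms(3) by (simp add: l_coset_eq_set_mult set_mult_assoc subgroup.subset)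
  ultimately show ?thesis by (simp add: coset_projection_def)
qed

definition subodometer :: "('g, 'm) monoid_scheme \<Rightarrow> (nat \<Rightarrow> 'g set) \<Rightarrow> (nat \<Rightarrow> 'g set) set" where
  "subodometer G \<Gamma> =
     {y \<in> (\<Pi>\<^sub>E i\<in>UNIV. lcosets\<^bsub>G\<^esub> (\<Gamma> i)). \<forall>i. coset_projection G \<Gamma> i (y (Suc i)) = y i}"

definition subodometer_topology ::
    "('g, 'm) monoid_scheme \<Rightarrow> (nat \<Rightarrow> 'g set) \<Rightarrow> (nat \<Rightarrow> 'g set) topology" where
  "subodometer_topology G \<Gamma> =
     subtopology (product_topology (\<lambda>i. discrete_topology (lcosets\<^bsub>G\<^esub> (\<Gamma> i))) UNIV)
       (subodometer G \<Gamma>)"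

text \<open>\<^const>\<open>group_action\<close> requires the maps to be extensional, whence the restrictions to the
  phase space here and in \<open>subshift_action\<close>.\<close>

definition subodometer_action ::
    "('g, 'm) monoid_scheme \<Rightarrow> (nat \<Rightarrow> 'g set) \<Rightarrow> 'g \<Rightarrow> (nat \<Rightarrow> 'g set) \<Rightarrow> (nat \<Rightarrow> 'g set)" where
  "subodometer_action G \<Gamma> g = (\<lambda>y\<in>subodometer G \<Gamma>. \<lambda>i. g <#\<^bsub>G\<^esub> y i)"


section \<open>Subshifts\<close>

definition full_shift :: "('g, 'm) monoid_scheme \<Rightarrow> 's set \<Rightarrow> ('g \<Rightarrow> 's) topology" where
  "full_shift G \<Sigma> = product_topology (\<lambda>_. discrete_topology \<Sigma>) (carrier G)"

definition shift :: "('g, 'm) monoid_scheme \<Rightarrow> 'g \<Rightarrow> ('g \<Rightarrow> 's) \<Rightarrow> ('g \<Rightarrow> 's)" where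
  "shift G \<gamma> x = (\<lambda>g\<in>carrier G. x (g \<otimes>\<^bsub>G\<^esub> \<gamma>))"

definition subshift :: "('g, 'm) monoid_scheme \<Rightarrow> 's set \<Rightarrow> ('g \<Rightarrow> 's) set \<Rightarrow> bool" where
  "subshift G \<Sigma> X \<longleftrightarrow>
     closedin (full_shift G \<Sigma>) X \<and> (\<forall>\<gamma>\<in>carrier G. \<forall>x\<in>X. shift G \<gamma> x \<in> X)"

definition subshift_topology ::
    "('g, 'm) monoid_scheme \<Rightarrow> 's set \<Rightarrow> ('g \<Rightarrow> 's) set \<Rightarrow> ('g \<Rightarrow> 's) topology" where
  "subshift_topology G \<Sigma> X = subtopology (full_shift G \<Sigma>) X"

definition subshift_action ::
    "('g, 'm) monoid_scheme \<Rightarrow> ('g \<Rightarrow> 's) set \<Rightarrow> 'g \<Rightarrow> ('g \<Rightarrow> 's) \<Rightarrow> ('g \<Rightarrow> 's)" where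
  "subshift_action G X \<gamma> = restrict (shift G \<gamma>) X"


section \<open>Toeplitz arrays\<close>

definition Per_symbol ::
    "('g, 'm) monoid_scheme \<Rightarrow> ('g \<Rightarrow> 's) \<Rightarrow> 'g set \<Rightarrow> 's \<Rightarrow> 'g set" where
  "Per_symbol G x \<Gamma> \<sigma> = {g \<in> carrier G. \<forall>\<gamma>\<in>\<Gamma>. x (g \<otimes>\<^bsub>G\<^esub> \<gamma>) = \<sigma>}"

definition Per ::
    "('g, 'm) monoid_scheme \<Rightarrow> 's set \<Rightarrow> ('g \<Rightarrow> 's) \<Rightarrow> 'g set \<Rightarrow> 'g set" where
  "Per G \<Sigma> x \<Gamma> = (\<Union>\<sigma>\<in>\<Sigma>. Per_symbol G x \<Gamma> \<sigma>)"

definition Toeplitz_array :: "('g, 'm) monoid_scheme \<Rightarrow> 's set \<Rightarrow> ('g \<Rightarrow> 's) \<Rightarrow> bool" where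
  "Toeplitz_array G \<Sigma> x \<longleftrightarrow>
     x \<in> topspace (full_shift G \<Sigma>) \<and>
     (\<forall>g\<in>carrier G. \<exists>\<Gamma>. syndetic_subgroup G \<Gamma> \<and> g \<in> Per G \<Sigma> x \<Gamma>)"

end

theory Submission
  imports Defs
begin

text \<open>If \<open>x\<close> is the only point over some point of a subodometer then, by compactness, each
  symbol of \<open>x\<close> is determined by finitely many coordinates of that point, whose stabilizer is a group of periods.
  Conversely, let \<open>x\<close> be a Toeplitz array and \<open>X\<close> its orbit closure. Uniform recurrence gives
  minimality. Choose a decreasing sequence of finite-index \<^emph>\<open>normal\<close> subgroups \<open>N n\<close> whose
  periodic parts exhaust \<open>x\<close>. By recurrence under \<open>N n\<close>, the closures of the pieces
  \<open>{g x | g \<in> a (N n)}\<close> of the orbit are equal or disjoint, so \<open>G\<close> permutes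
  a finite clopen partition of \<open>X\<close>; the stabilizers \<open>\<Gamma> n\<close> of the piece containing \<open>x\<close> define the
  subodometer. Working with normal subgroups avoids the notion of essential periods. The fibres
  are singletons over the dense orbit of the image of \<open>x\<close>, hence over a dense
  \<open>G\<^sub>\<delta>\<close> set, because each symbol is locally constant along the fibres there.\<close>

section \<open>Products of discrete spaces\<close>

text \<open>Cylinders fixing finitely many coordinates form a base of a product of discrete spaces.
  Openness thereby becomes a statement about finite sets \<open>F\<close> of coordinates.\<close>

lemma openin_product_discrete:
  "openin (product_topology (\<lambda>i. discrete_topology (D i)) I) U \<longleftrightarrow>
     U \<subseteq> PiE I D \<and>
     (\<forall>x\<in>U. \<exists>F. finite F \<and> F \<subseteq> I \<and> (\<forall>z\<in>PiE I D. (\<forall>i\<in>F. z i = x i) \<longrightarrow> z \<in> U))"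
  (is "?lhs \<longleftrightarrow> ?rhs")
proof
  assume L: ?lhs
  have "\<exists>F. finite F \<and> F \<subseteq> I \<and> (\<forall>z\<in>PiE I D. (\<forall>i\<in>F. z i = x i) \<longrightarrow> z \<in> U)"
    if x: "x \<in> U" for x
  proof -
    obtain V where V: "finite {i \<in> I. V i \<noteq> D i}" "\<forall>i\<in>I. V i \<subseteq> D i" "x \<in> PiE I V" "PiE I V \<subseteq> U"
      using L x unfolding openin_product_topology_alt by (auto simp: subset_iff)
    have "z \<in> U" if "z \<in> PiE I D" "\<forall>i\<in>{i \<in> I. V i \<noteq> D i}. z i = x i" for z
    proof -
      have "z \<in> PiE I V"
        using that V(3) by (force simp: PiE_iff)
      then show ?thesis using V(4) by blast
    qed
    then show ?thesis using V(1) by (intro exI[of _ "{i \<in> I. V i \<noteq> D i}"]) blast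
  qed
  moreover have "U \<subseteq> PiE I D" using openin_subset[OF L] by simp
  ultimately show ?rhs by blast
next
  assume R: ?rhs
  show ?lhs
    unfolding openin_product_topology_alt
  proof
    fix x assume x: "x \<in> U"
    then obtain F where F: "finite F" "F \<subseteq> I" "\<forall>z\<in>PiE I D. (\<forall>i\<in>F. z i = x i) \<longrightarrow> z \<in> U"
      using R by blast
    have xD: "x \<in> PiE I D" using R x by blast
    let ?V = "\<lambda>i. if i \<in> F then {x i} else D i"
    have "finite {i \<in> I. ?V i \<noteq> topspace (discrete_topology (D i))}"
      by (rule finite_subset[OF _ F(1)]) auto
    moreover have "\<forall>i\<in>I. openin (discrete_topology (D i)) (?V i)"
      using xD by (auto simp: PiE_iff)
    moreover have "x \<in> PiE I ?V" using xD by (auto simp: PiE_iff)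
    moreover have "PiE I ?V \<subseteq> U"
    proof
      fix z assume z: "z \<in> PiE I ?V"
      have "z i \<in> D i" if "i \<in> I" for i
      proof -
        have "z i \<in> ?V i" using z that by (rule PiE_mem)
        then show ?thesis using PiE_mem[OF xD that] by (auto split: if_splits)
      qed
      then have "z \<in> PiE I D" using z by (auto simp: PiE_iff)
      moreover have "\<forall>i\<in>F. z i = x i"
      proof
        fix i assume "i \<in> F"
        then show "z i = x i" using PiE_mem[OF z, of i] F(2) by auto
      qed
      ultimately show "z \<in> U" using F(3) by blast
    qed
    ultimately show "\<exists>V. finite {i \<in> I. V i \<noteq> topspace (discrete_topology (D i))} \<and>
        (\<forall>i\<in>I. openin (discrete_topology (D i)) (V i)) \<and> x \<in> PiE I V \<and> PiE I V \<subseteq> U"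
      by (intro exI[of _ ?V] conjI)
  qed
qed

lemma openin_product_discrete_cylinder:
  assumes "finite F" "F \<subseteq> I"
  shows "openin (product_topology (\<lambda>i. discrete_topology (D i)) I) {w \<in> PiE I D. \<forall>i\<in>F. w i = z i}"
  unfolding openin_product_discrete
proof (intro conjI ballI)
  fix x assume x: "x \<in> {w \<in> PiE I D. \<forall>i\<in>F. w i = z i}"
  show "\<exists>F'. finite F' \<and> F' \<subseteq> I \<and> (\<forall>w\<in>PiE I D. (\<forall>i\<in>F'. w i = x i) \<longrightarrow>
      w \<in> {w \<in> PiE I D. \<forall>i\<in>F. w i = z i})"
    by (rule exI[of _ F]) (use assms x in simp)
qed simp

text \<open>Testing against cylinders is enough to detect the closure: every finite pattern of
  \<open>z\<close> has to be shown by some member of \<open>S\<close>.\<close>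

lemma closure_of_product_discrete:
  assumes "S \<subseteq> PiE I D"
  shows "product_topology (\<lambda>i. discrete_topology (D i)) I closure_of S =
     {z \<in> PiE I D. \<forall>F. finite F \<longrightarrow> F \<subseteq> I \<longrightarrow> (\<exists>s\<in>S. \<forall>i\<in>F. s i = z i)}" (is "_ = ?R")
proof -
  let ?T = "product_topology (\<lambda>i. discrete_topology (D i)) I"
  show ?thesis
  proof (intro equalityI subsetI)
    fix z assume z: "z \<in> ?T closure_of S"
    have zD: "z \<in> PiE I D" using z by (simp add: in_closure_of)
    have "\<exists>s\<in>S. \<forall>i\<in>F. s i = z i" if F: "finite F" "F \<subseteq> I" for F
    proof -
      have "z \<in> {w \<in> PiE I D. \<forall>i\<in>F. w i = z i}" using zD by simp
      moreover have "\<And>U. z \<in> U \<Longrightarrow> openin ?T U \<Longrightarrow> \<exists>y. y \<in> S \<and> y \<in> U"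
        using z by (simp add: in_closure_of)
      ultimately obtain y where "y \<in> S" "y \<in> {w \<in> PiE I D. \<forall>i\<in>F. w i = z i}"
        using openin_product_discrete_cylinder[OF F, of D z] by meson
      then show ?thesis by blast
    qed
    then show "z \<in> ?R" using zD by blast
  next
    fix z assume z: "z \<in> ?R"
    have "\<exists>y. y \<in> S \<and> y \<in> U" if U: "z \<in> U" "openin ?T U" for U
    proof -
      obtain F where F: "finite F" "F \<subseteq> I" "\<forall>w\<in>PiE I D. (\<forall>i\<in>F. w i = z i) \<longrightarrow> w \<in> U"
        using U unfolding openin_product_discrete by blast
      obtain s where "s \<in> S" "\<forall>i\<in>F. s i = z i" using z F(1,2) by blast
      then show ?thesis using F(3) assms by blast
    qed
    then show "z \<in> ?T closure_of S" using z by (simp add: in_closure_of)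
  qed
qed

lemma metrizable_space_product_discrete:
  "countable I \<Longrightarrow> metrizable_space (product_topology (\<lambda>i. discrete_topology (D i)) I)"
  by (simp add: metrizable_space_product_topology)

lemma compact_space_product_discrete:
  "(\<And>i. i \<in> I \<Longrightarrow> finite (D i)) \<Longrightarrow>
     compact_space (product_topology (\<lambda>i. discrete_topology (D i)) I)"
  by (simp add: compact_space_product_topology compact_space_discrete_topology)

section \<open>Actions and cosets\<close>

text \<open>The generated set is exhausted by stages \<open>B n\<close>, each adding all products of
  two elements of the previous one, so every stage stays countable.\<close>

lemma countable_generate:
  assumes "countable S"
  shows "countable (generate G S)"
proof -
  let ?A = "S \<union> m_inv G ` S"
  define B where "B = rec_nat (insert \<one>\<^bsub>G\<^esub> ?A) (\<lambda>_ B. B \<union> (\<lambda>(a, b). a \<otimes>\<^bsub>G\<^esub> b) ` (B \<times> B))"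
  have B0: "B 0 = insert \<one>\<^bsub>G\<^esub> ?A"
    and BS: "B (Suc n) = B n \<union> (\<lambda>(a, b). a \<otimes>\<^bsub>G\<^esub> b) ` (B n \<times> B n)" for n
    by (simp_all add: B_def)
  have cB: "countable (B n)" for n
    by (induction n) (use assms in \<open>auto simp: B0 BS\<close>)
  have mono: "B n \<subseteq> B m" if "n \<le> m" for n m
    using that by (rule lift_Suc_mono_le[rotated]) (auto simp: BS)
  have "generate G S \<subseteq> (\<Union>n. B n)"
  proof
    fix h assume "h \<in> generate G S"
    then show "h \<in> (\<Union>n. B n)"
    proof induction
      case (eng h1 h2)
      \<comment> \<open>Both factors are moved to a common stage, because the product of a pair is
        formed from a single \<open>B n\<close>.\<close>
      then obtain n m where "h1 \<in> B n" "h2 \<in> B m" by blast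
      then have "h1 \<in> B (max n m)" "h2 \<in> B (max n m)"
        using mono[of n "max n m"] mono[of m "max n m"] by auto
      then have "h1 \<otimes>\<^bsub>G\<^esub> h2 \<in> B (Suc (max n m))" by (auto simp: BS)
      then show ?case by blast
    qed (use B0 in blast)+
  qed
  moreover have "countable (\<Union>n. B n)" using cB by blast
  ultimately show ?thesis by (rule countable_subset)
qed

text \<open>Bijectivity comes for free, since \<open>\<phi> (inv g)\<close> inverts
  \<open>\<phi> g\<close>. Extensionality is what turns pointwise multiplicativity into equality in
  \<open>BijGroup E\<close>.\<close>

lemma (in group) group_actionI:
  assumes ext: "\<And>g. g \<in> carrier G \<Longrightarrow> \<phi> g \<in> extensional E"
    and closed: "\<And>g x. g \<in> carrier G \<Longrightarrow> x \<in> E \<Longrightarrow> \<phi> g x \<in> E"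
    and one: "\<And>x. x \<in> E \<Longrightarrow> \<phi> \<one> x = x"
    and mult: "\<And>g h x. g \<in> carrier G \<Longrightarrow> h \<in> carrier G \<Longrightarrow> x \<in> E \<Longrightarrow> \<phi> (g \<otimes> h) x = \<phi> g (\<phi> h x)"
  shows "group_action G E \<phi>"
proof -
  have inv: "\<phi> (inv g) (\<phi> g x) = x" "\<phi> g (\<phi> (inv g) x) = x" if "g \<in> carrier G" "x \<in> E" for g x
    using that mult[of "inv g" g x] mult[of g "inv g" x] one by auto
  have bij: "\<phi> g \<in> Bij E" if "g \<in> carrier G" for g
    unfolding Bij_def using that ext closed inv
    by (auto intro!: bij_betw_byWitness[where f' = "\<phi> (inv g)"])
  have "\<phi> \<in> hom G (BijGroup E)"
  proof (rule homI)
    show "\<phi> g \<in> carrier (BijGroup E)" if "g \<in> carrier G" for g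
      using bij that by (simp add: BijGroup_def)
    show "\<phi> (g \<otimes> h) = \<phi> g \<otimes>\<^bsub>BijGroup E\<^esub> \<phi> h" if "g \<in> carrier G" "h \<in> carrier G" for g h
    proof
      fix x show "\<phi> (g \<otimes> h) x = (\<phi> g \<otimes>\<^bsub>BijGroup E\<^esub> \<phi> h) x"
        using that bij mult[OF that] ext[OF m_closed[OF that]]
        by (auto simp: BijGroup_def compose_def extensional_def)
    qed
  qed
  then show ?thesis
    unfolding group_action_def group_hom_def group_hom_axioms_def
    by (simp add: group_BijGroup is_group)
qed

text \<open>Continuity of every map suffices for homeomorphisms, because the inverse of
  \<open>\<phi> g\<close> is again a map of the action.\<close>

lemma (in group) dynamical_systemI:
  assumes "compact_space T" "metrizable_space T"
    and act: "group_action G (topspace T) \<phi>"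
    and cont: "\<And>g. g \<in> carrier G \<Longrightarrow> continuous_map T T (\<phi> g)"
  shows "dynamical_system G T \<phi>"
proof -
  interpret group_action G "topspace T" \<phi> by fact
  have "homeomorphic_map T T (\<phi> g)" if g: "g \<in> carrier G" for g
  proof -
    have "\<phi> (inv g) (\<phi> g x) = x" "\<phi> g (\<phi> (inv g) x) = x" if "x \<in> topspace T" for x
      using orbit_sym_aux[OF g that] orbit_sym_aux[OF inv_closed[OF g] that] g by auto
    then show ?thesis
      unfolding homeomorphic_map_maps homeomorphic_maps_def using cont g by blast
  qed
  then show ?thesis using assms unfolding dynamical_system_def by blast
qed

section \<open>Left cosets and subgroups of finite index\<close>

context group
begin

lemma mem_l_coset_iff:
  assumes "subgroup H G" "a \<in> carrier G"
  shows "b \<in> a <# H \<longleftrightarrow> b \<in> carrier G \<and> inv a \<otimes> b \<in> H"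
  using assms subgroup.lcos_module_imp[OF assms(1) is_group assms(2)]
    subgroup.lcos_module_rev[OF assms(1) is_group assms(2)] l_coset_carrier by blast

lemma l_coset_eq_iff:
  assumes "subgroup H G" "a \<in> carrier G" "b \<in> carrier G"
  shows "a <# H = b <# H \<longleftrightarrow> inv a \<otimes> b \<in> H"
  using assms by (metis l_repr_independence lcos_self mem_l_coset_iff)

lemma lcosets_iff: "C \<in> lcosets H \<longleftrightarrow> (\<exists>a\<in>carrier G. C = a <# H)"
  by (auto simp: LCOSETS_def)

text \<open>Each fibre of \<open>f\<close> lies in one left coset, so there are at most as many
  cosets as values of \<open>f\<close>. Finite index is thereby reduced to counting the values of a
  suitable \<open>f\<close>.\<close>

lemma finite_lcosetsI:
  assumes H: "subgroup H G" and fin: "finite (f ` carrier G)"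
    and f: "\<And>g h. g \<in> carrier G \<Longrightarrow> h \<in> carrier G \<Longrightarrow> f g = f h \<Longrightarrow> inv g \<otimes> h \<in> H"
  shows "finite (lcosets H)"
proof -
  have "C \<in> (\<lambda>v. inv_into (carrier G) f v <# H) ` f ` carrier G" if "C \<in> lcosets H" for C
  proof -
    obtain a where a: "a \<in> carrier G" "C = a <# H" using \<open>C \<in> lcosets H\<close> lcosets_iff by blast
    let ?b = "inv_into (carrier G) f (f a)"
    have "?b \<in> carrier G" "f ?b = f a" using a by (auto simp: inv_into_into f_inv_into_f)
    then have "?b <# H = a <# H" using f a l_coset_eq_iff[OF H] by metis
    then show ?thesis using a by blast
  qed
  then show ?thesis using fin by (meson finite_imageI finite_subset subsetI)
qed

text \<open>The representatives are taken inside \<open>C\<close> itself; the recurrence argument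
  needs this, as it controls quotients \<open>c \<otimes> inv d\<close> only for \<open>c\<close>
  and \<open>d\<close> in \<open>C\<close>.\<close>

lemma syndetic_imp_finite_reps:
  assumes "syndetic_subgroup G H" "C \<subseteq> carrier G"
  obtains R where "finite R" "R \<subseteq> C" "\<And>c. c \<in> C \<Longrightarrow> \<exists>d\<in>R. inv d \<otimes> c \<in> H"
proof -
  have H: "subgroup H G" "finite (lcosets H)" using assms(1) by (auto simp: syndetic_subgroup_def)
  let ?q = "\<lambda>c. c <# H"
  have "?q ` C \<subseteq> lcosets H" using assms(2) lcosets_iff by blast
  then have "finite (?q ` C)" using H(2) finite_subset by blast
  then have "\<exists>R\<subseteq>C. finite R \<and> ?q ` C = ?q ` R" by (rule finite_subset_image) simp
  then obtain R where R: "R \<subseteq> C" "finite R" "?q ` C = ?q ` R" by (elim exE conjE)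
  have "\<exists>d\<in>R. inv d \<otimes> c \<in> H" if "c \<in> C" for c
  proof -
    have "?q c \<in> ?q ` R" using imageI[OF \<open>c \<in> C\<close>, of ?q] unfolding R(3) .
    then obtain d where "d \<in> R" "?q d = ?q c" by (elim imageE) simp
    then show ?thesis using l_coset_eq_iff[OF H(1), of d c] R(1) assms(2) that by blast
  qed
  then show ?thesis using that R by blast
qed

text \<open>The pair of cosets of an element modulo \<open>H\<close> and \<open>K\<close> determines
  its coset modulo the intersection.\<close>

lemma syndetic_Int:
  assumes "syndetic_subgroup G H" "syndetic_subgroup G K"
  shows "syndetic_subgroup G (H \<inter> K)"
proof -
  have s: "subgroup H G" "subgroup K G" "finite (lcosets H)" "finite (lcosets K)"
    using assms by (auto simp: syndetic_subgroup_def)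
  have HK: "subgroup (H \<inter> K) G" using s subgroups_Inter_pair by blast
  have "finite (lcosets (H \<inter> K))"
  proof (rule finite_lcosetsI[OF HK])
    show "finite ((\<lambda>g. (g <# H, g <# K)) ` carrier G)"
      by (rule finite_subset[OF _ finite_cartesian_product[OF s(3,4)]]) (auto simp: LCOSETS_def)
  qed (use s l_coset_eq_iff in auto)
  then show ?thesis using HK by (simp add: syndetic_subgroup_def)
qed

lemma syndetic_carrier: "syndetic_subgroup G (carrier G)"
  unfolding syndetic_subgroup_def
proof
  show "subgroup (carrier G) G" by (rule subgroup_self)
  then show "finite (lcosets (carrier G))"
    by (rule finite_lcosetsI[where f = "\<lambda>_. ()"]) auto
qed

text \<open>The cosets of \<open>H\<close> refine those of \<open>K\<close>.\<close>

lemma syndetic_mono: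
  assumes "syndetic_subgroup G H" "subgroup K G" "H \<subseteq> K"
  shows "syndetic_subgroup G K"
proof -
  have H: "subgroup H G" "finite (lcosets H)" using assms(1) by (auto simp: syndetic_subgroup_def)
  have "finite (lcosets K)"
  proof (rule finite_lcosetsI[OF assms(2)])
    show "finite ((\<lambda>g. g <# H) ` carrier G)"
      by (rule finite_subset[OF _ H(2)]) (auto simp: LCOSETS_def)
  qed (use l_coset_eq_iff[OF H(1)] assms(3) in auto)
  then show ?thesis using assms(2) by (simp add: syndetic_subgroup_def)
qed

text \<open>Translation moves each \<open>C i\<close> within a finite set of cosets, and the tuple
  of translates \<open>g <# C i\<close> determines \<open>g\<close> modulo the joint stabilizer.
  With all cosets of one subgroup this yields the normal core, with a single coset a group of
  periods.\<close>

lemma syndetic_fixing_lcosets: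
  assumes H: "\<And>i. i \<in> F \<Longrightarrow> syndetic_subgroup G (H i)" and "finite F"
    and C: "\<And>i. i \<in> F \<Longrightarrow> C i \<in> lcosets (H i)"
  shows "syndetic_subgroup G {g \<in> carrier G. \<forall>i\<in>F. g <# C i = C i}" (is "syndetic_subgroup G ?S")
proof -
  have Csub: "C i \<subseteq> carrier G" if "i \<in> F" for i
    using H[OF that] C[OF that] subgroup.lcosets_carrier is_group
    by (auto simp: syndetic_subgroup_def)
  have inv: "inv g <# C i = C i" if "g \<in> carrier G" "i \<in> F" "g <# C i = C i" for g i
    using lcos_m_assoc[OF Csub[OF that(2)], of "inv g" g] that lcos_mult_one[OF Csub] by simp
  have S: "subgroup ?S G"
  proof
    show "x \<otimes> y \<in> ?S" if "x \<in> ?S" "y \<in> ?S" for x y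
      using that Csub by (auto simp: lcos_m_assoc[symmetric])
  qed (use inv Csub in \<open>auto simp: lcos_mult_one\<close>)
  have "finite (lcosets ?S)"
  proof (rule finite_lcosetsI[OF S])
    have "(\<lambda>g. \<lambda>i\<in>F. g <# C i) ` carrier G \<subseteq> PiE F (\<lambda>i. lcosets (H i))"
    proof clarify
      fix g assume g: "g \<in> carrier G"
      have "g <# C i \<in> lcosets (H i)" if "i \<in> F" for i
      proof -
        obtain a where "a \<in> carrier G" "C i = a <# H i" using C[OF \<open>i \<in> F\<close>] lcosets_iff by blast
        moreover have "H i \<subseteq> carrier G"
          using H[OF that] subgroup.subset by (auto simp: syndetic_subgroup_def)
        ultimately show ?thesis using g lcosets_iff lcos_m_assoc by (metis m_closed)
      qed
      then show "(\<lambda>i\<in>F. g <# C i) \<in> PiE F (\<lambda>i. lcosets (H i))" by auto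
    qed
    moreover have "finite (PiE F (\<lambda>i. lcosets (H i)))"
      using \<open>finite F\<close> H by (intro finite_PiE) (auto simp: syndetic_subgroup_def)
    ultimately show "finite ((\<lambda>g. \<lambda>i\<in>F. g <# C i) ` carrier G)" by (rule finite_subset)
    fix g h assume gh: "g \<in> carrier G" "h \<in> carrier G" "(\<lambda>i\<in>F. g <# C i) = (\<lambda>i\<in>F. h <# C i)"
    have "(inv g \<otimes> h) <# C i = C i" if "i \<in> F" for i
    proof -
      have "g <# C i = h <# C i" using fun_cong[OF gh(3), of i] that by simp
      then have "(inv g \<otimes> h) <# C i = inv g <# (g <# C i)"
        using Csub[OF that] gh by (simp add: lcos_m_assoc)
      also have "\<dots> = C i" using Csub[OF that] gh by (simp add: lcos_m_assoc lcos_mult_one)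
      finally show ?thesis .
    qed
    then show "inv g \<otimes> h \<in> ?S" using gh by auto
  qed
  then show ?thesis using S by (simp add: syndetic_subgroup_def)
qed

text \<open>\<open>?N\<close> is the normal core of \<open>H\<close>, the kernel of the action of
  the group on its left cosets modulo \<open>H\<close>.\<close>

lemma syndetic_imp_normal_syndetic:
  assumes "syndetic_subgroup G H"
  obtains N where "syndetic_subgroup G N" "N \<lhd> G" "N \<subseteq> H"
proof -
  let ?N = "{g \<in> carrier G. \<forall>C\<in>lcosets H. g <# C = C}"
  have H: "subgroup H G" "finite (lcosets H)" using assms by (auto simp: syndetic_subgroup_def)
  have Csub: "C \<subseteq> carrier G" if "C \<in> lcosets H" for C
    using H(1) that subgroup.lcosets_carrier is_group by blast
  have syn: "syndetic_subgroup G ?N"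
    by (rule syndetic_fixing_lcosets[where H = "\<lambda>_. H"]) (use assms H in auto)
  moreover have "?N \<lhd> G"
  proof -
    have "x \<otimes> h \<otimes> inv x \<in> ?N" if x: "x \<in> carrier G" and h: "h \<in> ?N" for x h
    proof -
      have "(x \<otimes> h \<otimes> inv x) <# C = C" if C: "C \<in> lcosets H" for C
      proof -
        have "inv x <# C \<in> lcosets H"
          using C x H(1) lcos_m_assoc[OF subgroup.subset[OF H(1)]] unfolding lcosets_iff
          by (metis inv_closed m_closed)
        then have "h <# (inv x <# C) = inv x <# C" using h by blast
        moreover have "(x \<otimes> h \<otimes> inv x) <# C = x <# (h <# (inv x <# C))"
          using x h Csub[OF C] by (simp add: lcos_m_assoc m_assoc l_coset_subset_G)
        ultimately show ?thesis using x Csub[OF C] by (simp add: lcos_m_assoc lcos_mult_one)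
      qed
      then show ?thesis using x h by auto
    qed
    then show ?thesis using syn normal_inv_iff by (auto simp: syndetic_subgroup_def)
  qed
  moreover have "?N \<subseteq> H"
  proof
    fix g assume g: "g \<in> ?N"
    have "\<one> <# H \<in> lcosets H" using lcosets_iff by blast
    then have "H \<in> lcosets H" using lcos_mult_one[OF subgroup.subset[OF H(1)]] by simp
    then have "g <# H = H" using g by blast
    then show "g \<in> H" using g lcos_self[OF _ H(1), of g] by auto
  qed
  ultimately show ?thesis using that by blast
qed

end

section \<open>Closures of pieces of the orbit of a Toeplitz array\<close>

context group
begin

section \<open>The shift action and closures of pieces of an orbit\<close>

lemma topspace_full_shift: "topspace (full_shift G \<Sigma>) = (\<Pi>\<^sub>E g\<in>carrier G. \<Sigma>)"
  by (simp add: full_shift_def)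

lemma shift_apply: "f \<in> carrier G \<Longrightarrow> shift G g x f = x (f \<otimes> g)"
  by (simp add: shift_def)

lemma shift_in_full_shift:
  "g \<in> carrier G \<Longrightarrow> x \<in> topspace (full_shift G \<Sigma>) \<Longrightarrow> shift G g x \<in> topspace (full_shift G \<Sigma>)"
  by (auto simp: topspace_full_shift shift_def PiE_iff)

lemma shift_mult:
  "g \<in> carrier G \<Longrightarrow> h \<in> carrier G \<Longrightarrow> shift G (g \<otimes> h) x = shift G g (shift G h x)"
  by (rule ext) (simp add: shift_def m_assoc)

lemma shift_one: "x \<in> topspace (full_shift G \<Sigma>) \<Longrightarrow> shift G \<one> x = x"
  by (rule ext) (auto simp: shift_def topspace_full_shift PiE_iff extensional_def)

lemma continuous_map_shift:
  assumes g: "g \<in> carrier G"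
  shows "continuous_map (full_shift G \<Sigma>) (full_shift G \<Sigma>) (shift G g)"
proof -
  have "continuous_map (full_shift G \<Sigma>) (discrete_topology \<Sigma>) (\<lambda>x. shift G g x f)"
    if f: "f \<in> carrier G" for f
    using continuous_map_product_projection[of "f \<otimes> g" "carrier G" "\<lambda>_. discrete_topology \<Sigma>"] f g
    by (simp add: shift_apply full_shift_def)
  then show ?thesis
    unfolding full_shift_def[of G \<Sigma>] continuous_map_componentwise
    by (auto simp: shift_def full_shift_def)
qed

text \<open>The set \<open>C\<close> of translating elements is a parameter, so that one notion
  covers both the whole orbit closure and the pieces given by cosets of a subgroup.\<close>

definition shift_closure :: "'s set \<Rightarrow> ('a \<Rightarrow> 's) \<Rightarrow> 'a set \<Rightarrow> ('a \<Rightarrow> 's) set" where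
  "shift_closure \<Sigma> x C = full_shift G \<Sigma> closure_of ((\<lambda>c. shift G c x) ` C)"

lemma closedin_shift_closure: "closedin (full_shift G \<Sigma>) (shift_closure \<Sigma> x C)"
  by (simp add: shift_closure_def)

lemma shift_closure_carrier: "shift_closure \<Sigma> x (carrier G) = full_shift G \<Sigma> closure_of orbit G (shift G) x"
  by (simp add: shift_closure_def orbit_def image_def Bex_def conj_commute)

lemma shift_closure_mono: "C \<subseteq> C' \<Longrightarrow> shift_closure \<Sigma> x C \<subseteq> shift_closure \<Sigma> x C'"
  unfolding shift_closure_def by (intro closure_of_mono image_mono)

text \<open>The combinatorial form of the closure: every finite pattern of \<open>z\<close> occurs
  in \<open>x\<close> at a translate by an element of \<open>C\<close>.\<close>

lemma mem_shift_closure_iff: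
  assumes "x \<in> topspace (full_shift G \<Sigma>)" "C \<subseteq> carrier G"
  shows "z \<in> shift_closure \<Sigma> x C \<longleftrightarrow> z \<in> topspace (full_shift G \<Sigma>) \<and>
     (\<forall>F. finite F \<longrightarrow> F \<subseteq> carrier G \<longrightarrow> (\<exists>c\<in>C. \<forall>f\<in>F. x (f \<otimes> c) = z f))"
proof -
  have sub: "(\<lambda>c. shift G c x) ` C \<subseteq> (\<Pi>\<^sub>E g\<in>carrier G. \<Sigma>)"
  proof (rule image_subsetI)
    fix c assume "c \<in> C"
    then show "shift G c x \<in> (\<Pi>\<^sub>E g\<in>carrier G. \<Sigma>)"
      using shift_in_full_shift[of c x \<Sigma>] assms unfolding topspace_full_shift by blast
  qed
  have eq: "(\<exists>c\<in>C. \<forall>f\<in>F. shift G c x f = z f) \<longleftrightarrow> (\<exists>c\<in>C. \<forall>f\<in>F. x (f \<otimes> c) = z f)"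
    if "F \<subseteq> carrier G" for F
    using that by (auto simp: shift_apply subset_iff)
  show ?thesis
    unfolding shift_closure_def topspace_full_shift
    unfolding full_shift_def closure_of_product_discrete[OF sub]
    by (simp add: eq cong: imp_cong)
qed

text \<open>The pattern of \<open>shift G g z\<close> on \<open>F\<close> is the pattern of
  \<open>z\<close> on the translate of \<open>F\<close> by \<open>g\<close>; an element
  \<open>c\<close> realizing the latter gives \<open>g \<otimes> c\<close> for the former.\<close>

lemma shift_mem_shift_closure:
  assumes x: "x \<in> topspace (full_shift G \<Sigma>)" and C: "C \<subseteq> carrier G"
    and z: "z \<in> shift_closure \<Sigma> x C" and g: "g \<in> carrier G"
  shows "shift G g z \<in> shift_closure \<Sigma> x (g <# C)"
proof -
  have z': "z \<in> topspace (full_shift G \<Sigma>)"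
    using z mem_shift_closure_iff[OF x C] by blast
  have "\<exists>c\<in>g <# C. \<forall>f\<in>F. x (f \<otimes> c) = shift G g z f" if F: "finite F" "F \<subseteq> carrier G" for F
  proof -
    have "finite ((\<lambda>f. f \<otimes> g) ` F)" "(\<lambda>f. f \<otimes> g) ` F \<subseteq> carrier G" using F g by auto
    then obtain c where c: "c \<in> C" "\<forall>f\<in>(\<lambda>f. f \<otimes> g) ` F. x (f \<otimes> c) = z f"
      using z mem_shift_closure_iff[OF x C] by meson
    have cG: "c \<in> carrier G" using c(1) C by blast
    have "x (f \<otimes> (g \<otimes> c)) = shift G g z f" if f: "f \<in> F" for f
    proof -
      have fG: "f \<in> carrier G" using f F by blast
      have "x ((f \<otimes> g) \<otimes> c) = z (f \<otimes> g)" using c(2) f by blast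
      then show ?thesis using fG g cG by (simp add: shift_apply m_assoc)
    qed
    moreover have "g \<otimes> c \<in> g <# C" using c(1) by (auto simp: l_coset_def)
    ultimately show ?thesis by blast
  qed
  then show ?thesis
    using mem_shift_closure_iff[OF x l_coset_subset_G[OF C g]] shift_in_full_shift[OF g z'] by blast
qed

lemma self_mem_shift_closure:
  assumes "x \<in> topspace (full_shift G \<Sigma>)" "C \<subseteq> carrier G" "c \<in> C"
  shows "shift G c x \<in> shift_closure \<Sigma> x C"
proof -
  have "(\<lambda>c. shift G c x) ` C \<subseteq> topspace (full_shift G \<Sigma>)"
  proof (rule image_subsetI)
    fix c assume "c \<in> C"
    then show "shift G c x \<in> topspace (full_shift G \<Sigma>)"
      using shift_in_full_shift[of c x \<Sigma>] assms by blast
  qed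
  from closure_of_subset[OF this] show ?thesis
    unfolding shift_closure_def using assms(3) by blast
qed

text \<open>Closure commutes with finite unions. This is how finite index lets the closed pieces
  cover the whole orbit closure.\<close>

lemma shift_closure_Union:
  assumes "finite \<C>"
  shows "shift_closure \<Sigma> x (\<Union>\<C>) = (\<Union>C\<in>\<C>. shift_closure \<Sigma> x C)"
proof -
  have "(\<lambda>c. shift G c x) ` (\<Union>\<C>) = \<Union>((\<lambda>C. (\<lambda>c. shift G c x) ` C) ` \<C>)" by blast
  then show ?thesis
    unfolding shift_closure_def by (simp only: closure_of_Union[OF finite_imageI[OF assms]] image_image)
qed

text \<open>The period groups of finitely many positions are intersected; finite index
  survives.\<close>

lemma Toeplitz_array_periods:
  assumes x: "Toeplitz_array G \<Sigma> x" and F: "finite F" "F \<subseteq> carrier G"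
  shows "\<exists>\<Delta>. syndetic_subgroup G \<Delta> \<and> (\<forall>f\<in>F. \<forall>\<delta>\<in>\<Delta>. x (f \<otimes> \<delta>) = x f)"
  using F
proof (induction F rule: finite_induct)
  case empty
  then show ?case using syndetic_carrier by blast
next
  case (insert g F)
  then obtain \<Delta> where \<Delta>: "syndetic_subgroup G \<Delta>" "\<forall>f\<in>F. \<forall>\<delta>\<in>\<Delta>. x (f \<otimes> \<delta>) = x f" by blast
  have g: "g \<in> carrier G" using insert by blast
  obtain H where H: "syndetic_subgroup G H" "g \<in> Per G \<Sigma> x H"
    using x g unfolding Toeplitz_array_def by blast
  then obtain \<sigma> where \<sigma>: "\<forall>\<gamma>\<in>H. x (g \<otimes> \<gamma>) = \<sigma>" unfolding Per_def Per_symbol_def by blast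
  \<comment> \<open>The neutral element identifies the constant symbol \<open>\<sigma>\<close> as
    \<open>x g\<close>.\<close>
  have "\<one> \<in> H" using H(1) subgroup.one_closed by (auto simp: syndetic_subgroup_def)
  then have "x (g \<otimes> \<one>) = \<sigma>" using \<sigma> by blast
  then have "x g = \<sigma>" using g by simp
  then have "\<forall>f\<in>insert g F. \<forall>\<delta>\<in>\<Delta> \<inter> H. x (f \<otimes> \<delta>) = x f" using \<sigma> \<Delta>(2) by blast
  then show ?case using syndetic_Int[OF \<Delta>(1) H(1)] by blast
qed

text \<open>Uniform recurrence. Let \<open>\<Delta>\<close> be a group of periods for the pattern of \<open>x\<close> on \<open>F c\<close>, and let
  \<open>R \<subseteq> C\<close> represent \<open>C\<close> modulo \<open>\<Delta>\<close>. If \<open>z\<close> agrees with \<open>shift b x\<close> on the finite set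
  \<open>F {c d\<^sup>-\<^sup>1 | d \<in> R}\<close> and \<open>d \<in> R\<close> represents \<open>b\<close>, then \<open>n = c d\<^sup>-\<^sup>1\<close> brings the pattern back,
  because \<open>n b \<in> c \<Delta>\<close>.\<close>

lemma Toeplitz_array_recurrent:
  assumes x: "Toeplitz_array G \<Sigma> x" and C: "C \<subseteq> carrier G"
    and N: "\<And>c d. c \<in> C \<Longrightarrow> d \<in> C \<Longrightarrow> c \<otimes> inv d \<in> N"
    and z: "z \<in> shift_closure \<Sigma> x C" and c: "c \<in> C" and F: "finite F" "F \<subseteq> carrier G"
  shows "\<exists>n\<in>N. \<forall>f\<in>F. z (f \<otimes> n) = x (f \<otimes> c)"
proof -
  have x': "x \<in> topspace (full_shift G \<Sigma>)" using x by (simp add: Toeplitz_array_def)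
  have cG: "c \<in> carrier G" using C c by blast
  have "finite ((\<lambda>f. f \<otimes> c) ` F)" "(\<lambda>f. f \<otimes> c) ` F \<subseteq> carrier G" using F cG by auto
  from Toeplitz_array_periods[OF x this] obtain \<Delta> where \<Delta>: "syndetic_subgroup G \<Delta>"
    "\<forall>f\<in>(\<lambda>f. f \<otimes> c) ` F. \<forall>\<delta>\<in>\<Delta>. x (f \<otimes> \<delta>) = x f" by blast
  obtain R where R: "finite R" "R \<subseteq> C" "\<And>b. b \<in> C \<Longrightarrow> \<exists>d\<in>R. inv d \<otimes> b \<in> \<Delta>"
    using syndetic_imp_finite_reps[OF \<Delta>(1) C] by blast
  let ?E = "(\<lambda>(f, d). f \<otimes> (c \<otimes> inv d)) ` (F \<times> R)"
  have "finite ?E" using F R by blast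
  moreover have "?E \<subseteq> carrier G"
  proof clarify
    fix f d assume "f \<in> F" "d \<in> R"
    then have "f \<in> carrier G" "d \<in> carrier G" using F R C by blast+
    then show "f \<otimes> (c \<otimes> inv d) \<in> carrier G" using cG by simp
  qed
  ultimately obtain b where b: "b \<in> C" "\<forall>f\<in>?E. x (f \<otimes> b) = z f"
    using z mem_shift_closure_iff[OF x' C] by meson
  obtain d where d: "d \<in> R" "inv d \<otimes> b \<in> \<Delta>" using R(3) b(1) by blast
  have G: "d \<in> carrier G" "b \<in> carrier G" using d b R C by auto
  have "z (f \<otimes> (c \<otimes> inv d)) = x (f \<otimes> c)" if f: "f \<in> F" for f
  proof -
    have fG: "f \<in> carrier G" using f F by blast
    have "z (f \<otimes> (c \<otimes> inv d)) = x (f \<otimes> (c \<otimes> inv d) \<otimes> b)" using b(2) f d(1) by simp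
    also have "\<dots> = x ((f \<otimes> c) \<otimes> (inv d \<otimes> b))" using fG cG G by (simp add: m_assoc)
    also have "\<dots> = x (f \<otimes> c)" using \<Delta>(2) f d(2) by blast
    finally show ?thesis .
  qed
  then show ?thesis using N[OF c, of d] d(1) R(2) by blast
qed

text \<open>A pattern of \<open>w\<close> on \<open>F\<close> occurs in \<open>x\<close> at some
  \<open>c\<close> in \<open>C\<close>. By recurrence \<open>z\<close> shows it again at some
  \<open>n\<close> in \<open>N\<close>, and approximating \<open>z\<close> on the translate of
  \<open>F\<close> by \<open>n\<close> yields \<open>c'\<close> in \<open>C'\<close>. The pattern
  thus occurs in \<open>x\<close> at \<open>n \<otimes> c'\<close>, which stays in
  \<open>C'\<close>.\<close>

lemma shift_closure_subset_of_common_point: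
  assumes x: "Toeplitz_array G \<Sigma> x" and C: "C \<subseteq> carrier G" "C' \<subseteq> carrier G" and N: "N \<subseteq> carrier G"
    and "\<And>c d. c \<in> C \<Longrightarrow> d \<in> C \<Longrightarrow> c \<otimes> inv d \<in> N"
    and N': "\<And>n c. n \<in> N \<Longrightarrow> c \<in> C' \<Longrightarrow> n \<otimes> c \<in> C'"
    and z: "z \<in> shift_closure \<Sigma> x C" "z \<in> shift_closure \<Sigma> x C'"
  shows "shift_closure \<Sigma> x C \<subseteq> shift_closure \<Sigma> x C'"
proof
  fix w assume w: "w \<in> shift_closure \<Sigma> x C"
  have x': "x \<in> topspace (full_shift G \<Sigma>)" using x by (simp add: Toeplitz_array_def)
  have "\<exists>c\<in>C'. \<forall>f\<in>F. x (f \<otimes> c) = w f" if F: "finite F" "F \<subseteq> carrier G" for F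
  proof -
    obtain c where c: "c \<in> C" "\<forall>f\<in>F. x (f \<otimes> c) = w f"
      using w F mem_shift_closure_iff[OF x' C(1)] by meson
    obtain n where n: "n \<in> N" "\<forall>f\<in>F. z (f \<otimes> n) = x (f \<otimes> c)"
      using Toeplitz_array_recurrent[OF x C(1) assms(5) z(1) c(1) F] by blast
    have nG: "n \<in> carrier G" using n N by blast
    have "finite ((\<lambda>f. f \<otimes> n) ` F)" "(\<lambda>f. f \<otimes> n) ` F \<subseteq> carrier G" using F nG by auto
    then obtain c' where c': "c' \<in> C'" "\<forall>f\<in>(\<lambda>f. f \<otimes> n) ` F. x (f \<otimes> c') = z f"
      using z(2) mem_shift_closure_iff[OF x' C(2)] by meson
    have c'G: "c' \<in> carrier G" using c' C by blast
    have "x (f \<otimes> (n \<otimes> c')) = w f" if f: "f \<in> F" for f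
    proof -
      have fG: "f \<in> carrier G" using f F by blast
      have "x (f \<otimes> n \<otimes> c') = z (f \<otimes> n)" using c'(2) f by blast
      then show ?thesis using n(2) c(2) f fG nG c'G by (simp add: m_assoc)
    qed
    then show ?thesis using N'[OF n(1) c'(1)] by blast
  qed
  moreover have "w \<in> topspace (full_shift G \<Sigma>)" using w mem_shift_closure_iff[OF x' C(1)] by blast
  ultimately show "w \<in> shift_closure \<Sigma> x C'" using mem_shift_closure_iff[OF x' C(2)] by blast
qed

text \<open>Here normality enters: a left coset is also a right coset, so multiplication by
  \<open>N\<close> from the left preserves it. These are the two closure conditions that the
  comparison of orbit pieces asks for.\<close>

lemma normal_coset_translates:
  assumes "N \<lhd> G" "a \<in> carrier G"
  shows "c \<in> a <# N \<Longrightarrow> d \<in> a <# N \<Longrightarrow> c \<otimes> inv d \<in> N"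
    and "n \<in> N \<Longrightarrow> c \<in> a <# N \<Longrightarrow> n \<otimes> c \<in> a <# N"
proof -
  interpret normal N G by fact
  have eq: "a <# N = N #> a" using coset_eq assms(2) by blast
  show "c \<otimes> inv d \<in> N" if cd: "c \<in> a <# N" "d \<in> a <# N"
  proof -
    obtain m n where mn: "m \<in> N" "n \<in> N" "c = m \<otimes> a" "d = n \<otimes> a"
      using cd unfolding eq r_coset_def by blast
    then have "c \<otimes> inv d = m \<otimes> (a \<otimes> (inv a \<otimes> inv n))"
      using assms(2) mem_carrier by (simp add: inv_mult_group m_assoc)
    also have "\<dots> = m \<otimes> inv n"
      using assms(2) mn mem_carrier by (simp add: m_assoc[symmetric])
    finally show ?thesis using mn by simp
  qed
  show "n \<otimes> c \<in> a <# N" if nc: "n \<in> N" "c \<in> a <# N"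
  proof -
    obtain m where m: "m \<in> N" "c = m \<otimes> a" using nc unfolding eq r_coset_def by blast
    then have "n \<otimes> c = (n \<otimes> m) \<otimes> a" using assms(2) nc mem_carrier by (simp add: m_assoc)
    then show ?thesis using m(1) nc(1) unfolding eq r_coset_def by blast
  qed
qed

text \<open>The previous inclusion applies in both directions, which makes the pieces belonging to
  cosets of \<open>N\<close> equal or disjoint.\<close>

lemma shift_closure_cosets_eq:
  assumes "Toeplitz_array G \<Sigma> x" "N \<lhd> G" "a \<in> carrier G" "b \<in> carrier G"
    and z: "z \<in> shift_closure \<Sigma> x (a <# N)" "z \<in> shift_closure \<Sigma> x (b <# N)"
  shows "shift_closure \<Sigma> x (a <# N) = shift_closure \<Sigma> x (b <# N)"
proof -
  have N: "N \<subseteq> carrier G" using assms(2) normal_imp_subgroup subgroup.subset by blast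
  have sub: "a <# N \<subseteq> carrier G" "b <# N \<subseteq> carrier G" using N assms l_coset_subset_G by auto
  note t = normal_coset_translates[OF assms(2,3)] normal_coset_translates[OF assms(2,4)]
  show ?thesis
    using shift_closure_subset_of_common_point[OF assms(1) sub N t(1) t(4) z]
      shift_closure_subset_of_common_point[OF assms(1) sub(2,1) N t(3) t(2) z(2,1)] by blast
qed

end

section \<open>Subodometers\<close>

locale subodometer_group = group G for G (structure) +
  fixes \<Gamma> :: "nat \<Rightarrow> 'a set"
  assumes seq: "subodometer_sequence G \<Gamma>"
begin

lemma subgroup_seq: "subgroup (\<Gamma> i) G" and finite_lcosets_seq: "finite (lcosets (\<Gamma> i))"
  and syndetic_seq: "syndetic_subgroup G (\<Gamma> i)"
  using seq by (auto simp: subodometer_sequence_def syndetic_subgroup_def)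

lemma mem_subodometer_iff:
  "y \<in> subodometer G \<Gamma> \<longleftrightarrow> (\<forall>i. y i \<in> lcosets (\<Gamma> i)) \<and> (\<forall>i. coset_projection G \<Gamma> i (y (Suc i)) = y i)"
  by (auto simp: subodometer_def)

lemma topspace_subodometer_topology: "topspace (subodometer_topology G \<Gamma>) = subodometer G \<Gamma>"
  by (auto simp: subodometer_topology_def subodometer_def)

lemma subodometerE:
  assumes "y \<in> subodometer G \<Gamma>"
  obtains a where "a \<in> carrier G" "y n = a <# \<Gamma> n"
  using assms unfolding mem_subodometer_iff lcosets_iff by blast

text \<open>Each coordinate is the projection of the next one, so agreement propagates downwards
  from \<open>n\<close>.\<close>

lemma subodometer_eq_below:
  assumes "y \<in> subodometer G \<Gamma>" "z \<in> subodometer G \<Gamma>" "y n = z n" "i \<le> n"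
  shows "y i = z i"
  using assms(4,3)
proof (induction rule: inc_induct)
  case (step k)
  then show ?case using assms(1,2) unfolding mem_subodometer_iff by metis
qed

lemma coset_sequence_mem_subodometer:
  "a \<in> carrier G \<Longrightarrow> (\<lambda>i. a <# \<Gamma> i) \<in> subodometer G \<Gamma>"
  using coset_projection_l_coset[OF is_group seq] unfolding mem_subodometer_iff lcosets_iff by auto

lemma translate_mem_subodometer:
  assumes "g \<in> carrier G" "y \<in> subodometer G \<Gamma>"
  shows "(\<lambda>i. g <# y i) \<in> subodometer G \<Gamma>"
  unfolding mem_subodometer_iff
proof (intro conjI allI)
  fix i
  obtain a where a: "a \<in> carrier G" "y (Suc i) = a <# \<Gamma> (Suc i)" using assms(2) by (rule subodometerE)
  have "y i = coset_projection G \<Gamma> i (y (Suc i))" using assms(2) by (simp add: mem_subodometer_iff)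
  \<comment> \<open>A representative of coordinate \<open>Suc i\<close> also represents coordinate
    \<open>i\<close>.\<close>
  then have yi: "y i = a <# \<Gamma> i" using coset_projection_l_coset[OF is_group seq a(1)] a(2) by simp
  have "g <# y j = (g \<otimes> a) <# \<Gamma> j" if "y j = a <# \<Gamma> j" for j
    using that assms(1) a(1) by (simp add: lcos_m_assoc subgroup.subset[OF subgroup_seq])
  then have ga: "g <# y i = (g \<otimes> a) <# \<Gamma> i" "g <# y (Suc i) = (g \<otimes> a) <# \<Gamma> (Suc i)"
    using yi a(2) by blast+
  show "g <# y i \<in> lcosets (\<Gamma> i)" unfolding ga(1) lcosets_iff using assms(1) a(1) by blast
  show "coset_projection G \<Gamma> i (g <# y (Suc i)) = g <# y i"
    unfolding ga using coset_projection_l_coset[OF is_group seq] assms(1) a(1) by simp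
qed

text \<open>A coordinate determines all earlier ones, so a basic neighbourhood is given by a single
  coordinate \<open>n\<close> in place of a finite set of them.\<close>

lemma openin_subodometer_iff:
  "openin (subodometer_topology G \<Gamma>) U \<longleftrightarrow>
     U \<subseteq> subodometer G \<Gamma> \<and> (\<forall>y\<in>U. \<exists>n. \<forall>z\<in>subodometer G \<Gamma>. z n = y n \<longrightarrow> z \<in> U)"
  (is "_ \<longleftrightarrow> ?rhs")
proof
  let ?P = "PiE UNIV (\<lambda>i. lcosets (\<Gamma> i))"
  have sub: "subodometer G \<Gamma> \<subseteq> ?P" by (auto simp: subodometer_def)
  {
    assume "openin (subodometer_topology G \<Gamma>) U"
    then obtain V where V: "U = V \<inter> subodometer G \<Gamma>"
      "openin (product_topology (\<lambda>i. discrete_topology (lcosets (\<Gamma> i))) UNIV) V"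
      unfolding subodometer_topology_def openin_subtopology by blast
    have "\<exists>n. \<forall>z\<in>subodometer G \<Gamma>. z n = y n \<longrightarrow> z \<in> U" if y: "y \<in> U" for y
    proof -
      have yV: "y \<in> V" "y \<in> subodometer G \<Gamma>" using y V(1) by auto
      then obtain F where F: "finite F" "\<forall>z\<in>?P. (\<forall>i\<in>F. z i = y i) \<longrightarrow> z \<in> V"
        using V(2) unfolding openin_product_discrete by blast
      \<comment> \<open>The largest index in \<open>F\<close> controls all of \<open>F\<close>;
        inserting \<open>0\<close> keeps \<open>Max\<close> meaningful when \<open>F\<close> is
        empty.\<close>
      have "z \<in> U" if z: "z \<in> subodometer G \<Gamma>" "z (Max (insert 0 F)) = y (Max (insert 0 F))" for z
      proof -
        have "z i = y i" if "i \<in> F" for i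
          by (rule subodometer_eq_below[OF z(1) yV(2) z(2)]) (use that F(1) in simp)
        then have "z \<in> V" using F(2) z(1) sub by blast
        then show ?thesis using V(1) z(1) by blast
      qed
      then show ?thesis by blast
    qed
    then show ?rhs using V(1) by blast
  }
  assume R: ?rhs
  \<comment> \<open>\<open>?V\<close> is the union of all one-coordinate cylinders of the ambient
    product whose trace on the subodometer lies in \<open>U\<close>.\<close>
  let ?V = "{w \<in> ?P. \<exists>y\<in>U. \<exists>n. w n = y n \<and> (\<forall>z\<in>subodometer G \<Gamma>. z n = y n \<longrightarrow> z \<in> U)}"
  have "openin (product_topology (\<lambda>i. discrete_topology (lcosets (\<Gamma> i))) UNIV) ?V"
    unfolding openin_product_discrete
  proof (intro conjI ballI)
    fix w assume "w \<in> ?V"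
    then obtain y n where yn: "y \<in> U" "w n = y n" "\<forall>z\<in>subodometer G \<Gamma>. z n = y n \<longrightarrow> z \<in> U" by blast
    have "\<forall>v\<in>?P. (\<forall>i\<in>{n}. v i = w i) \<longrightarrow> v \<in> ?V"
    proof (intro ballI impI)
      fix v assume "v \<in> ?P" "\<forall>i\<in>{n}. v i = w i"
      moreover from this have "v n = y n" using yn(2) by simp
      ultimately show "v \<in> ?V" using yn(1,3) by blast
    qed
    then show "\<exists>F. finite F \<and> F \<subseteq> UNIV \<and> (\<forall>v\<in>?P. (\<forall>i\<in>F. v i = w i) \<longrightarrow> v \<in> ?V)"
      by (intro exI[of _ "{n}"]) simp
  qed blast
  moreover have "U = ?V \<inter> subodometer G \<Gamma>"
  proof (intro equalityI subsetI)
    fix y assume "y \<in> U"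
    then show "y \<in> ?V \<inter> subodometer G \<Gamma>" using R sub by blast
  next
    fix y assume "y \<in> ?V \<inter> subodometer G \<Gamma>"
    then show "y \<in> U" by blast
  qed
  ultimately show "openin (subodometer_topology G \<Gamma>) U"
    unfolding subodometer_topology_def openin_subtopology by blast
qed

text \<open>A density criterion: meeting every coset at every level means meeting every basic
  neighbourhood.\<close>

lemma closure_of_subodometer_eq:
  assumes "S \<subseteq> subodometer G \<Gamma>"
    and S: "\<And>a n. a \<in> carrier G \<Longrightarrow> \<exists>s\<in>S. s n = a <# \<Gamma> n"
  shows "subodometer_topology G \<Gamma> closure_of S = topspace (subodometer_topology G \<Gamma>)"
proof (intro equalityI subsetI)
  fix y assume "y \<in> topspace (subodometer_topology G \<Gamma>)"
  then have y: "y \<in> subodometer G \<Gamma>" by (simp add: topspace_subodometer_topology)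
  have "\<exists>s. s \<in> S \<and> s \<in> U" if "y \<in> U" "openin (subodometer_topology G \<Gamma>) U" for U
  proof -
    have "\<exists>n. \<forall>z\<in>subodometer G \<Gamma>. z n = y n \<longrightarrow> z \<in> U"
      using that unfolding openin_subodometer_iff by blast
    then obtain n where n: "\<forall>z\<in>subodometer G \<Gamma>. z n = y n \<longrightarrow> z \<in> U" ..
    obtain a where a: "a \<in> carrier G" "y n = a <# \<Gamma> n" using y by (rule subodometerE)
    obtain s where "s \<in> S" "s n = y n" using S[OF a(1), of n] unfolding a(2) by blast
    then show ?thesis using n assms(1) by blast
  qed
  then show "y \<in> subodometer_topology G \<Gamma> closure_of S"
    using y by (simp add: in_closure_of topspace_subodometer_topology)
qed (simp add: in_closure_of)

text \<open>A violated compatibility condition involves just the coordinates \<open>i\<close> and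
  \<open>Suc i\<close>, so it persists on a cylinder.\<close>

lemma closedin_subodometer:
  "closedin (product_topology (\<lambda>i. discrete_topology (lcosets (\<Gamma> i))) UNIV) (subodometer G \<Gamma>)"
  (is "closedin ?T _")
proof -
  let ?P = "PiE UNIV (\<lambda>i. lcosets (\<Gamma> i))"
  have "openin ?T (?P - subodometer G \<Gamma>)"
    unfolding openin_product_discrete
  proof (intro conjI ballI)
    fix w assume "w \<in> ?P - subodometer G \<Gamma>"
    then obtain i where i: "coset_projection G \<Gamma> i (w (Suc i)) \<noteq> w i"
      unfolding subodometer_def by auto
    have "\<forall>z\<in>?P. (\<forall>j\<in>{i, Suc i}. z j = w j) \<longrightarrow> z \<in> ?P - subodometer G \<Gamma>"
    proof (intro ballI impI DiffI notI)
      fix z assume z: "\<forall>j\<in>{i, Suc i}. z j = w j" "z \<in> subodometer G \<Gamma>"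
      have "coset_projection G \<Gamma> i (z (Suc i)) = z i" using z(2) unfolding mem_subodometer_iff by blast
      then show False using z(1) i by simp
    qed
    then show "\<exists>F. finite F \<and> F \<subseteq> UNIV \<and>
        (\<forall>z\<in>?P. (\<forall>j\<in>F. z j = w j) \<longrightarrow> z \<in> ?P - subodometer G \<Gamma>)"
      by (intro exI[of _ "{i, Suc i}"]) simp
  qed blast
  then show ?thesis
    unfolding closedin_def by (auto simp: subodometer_def)
qed

lemma dynamical_system_subodometer:
  "dynamical_system G (subodometer_topology G \<Gamma>) (subodometer_action G \<Gamma>)"
proof (rule dynamical_systemI)
  have "compact_space (product_topology (\<lambda>i. discrete_topology (lcosets (\<Gamma> i))) UNIV)"
    by (rule compact_space_product_discrete) (rule finite_lcosets_seq)
  then show "compact_space (subodometer_topology G \<Gamma>)"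
    unfolding subodometer_topology_def
    by (intro compact_space_subtopology closedin_compact_space closedin_subodometer)
  show "metrizable_space (subodometer_topology G \<Gamma>)"
    unfolding subodometer_topology_def
    by (intro metrizable_space_subtopology metrizable_space_product_discrete) simp
  have Csub: "y i \<subseteq> carrier G" if "y \<in> subodometer G \<Gamma>" for y i
    using that subgroup.lcosets_carrier[OF subgroup_seq is_group] by (auto simp: mem_subodometer_iff)
  show "group_action G (topspace (subodometer_topology G \<Gamma>)) (subodometer_action G \<Gamma>)"
    unfolding topspace_subodometer_topology
    by (rule group_actionI)
      (auto simp: subodometer_action_def translate_mem_subodometer lcos_mult_one Csub lcos_m_assoc)
  fix g assume g: "g \<in> carrier G"
  show "continuous_map (subodometer_topology G \<Gamma>) (subodometer_topology G \<Gamma>) (subodometer_action G \<Gamma> g)"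
    unfolding continuous_map_def topspace_subodometer_topology
  proof (intro conjI allI impI)
    show "subodometer_action G \<Gamma> g \<in> subodometer G \<Gamma> \<rightarrow> subodometer G \<Gamma>"
      using g by (simp add: subodometer_action_def translate_mem_subodometer)
    fix U assume U: "openin (subodometer_topology G \<Gamma>) U"
    let ?W = "{y \<in> subodometer G \<Gamma>. subodometer_action G \<Gamma> g y \<in> U}"
    have "\<exists>n. \<forall>z\<in>subodometer G \<Gamma>. z n = y n \<longrightarrow> z \<in> ?W" if y: "y \<in> ?W" for y
    proof -
      have "subodometer_action G \<Gamma> g y \<in> U" using y by blast
      then have "\<exists>n. \<forall>z\<in>subodometer G \<Gamma>. z n = subodometer_action G \<Gamma> g y n \<longrightarrow> z \<in> U"
        using U unfolding openin_subodometer_iff by blast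
      then obtain n where n: "\<forall>z\<in>subodometer G \<Gamma>. z n = subodometer_action G \<Gamma> g y n \<longrightarrow> z \<in> U" ..
      have "z \<in> ?W" if "z \<in> subodometer G \<Gamma>" "z n = y n" for z
        using n that y g by (simp add: subodometer_action_def translate_mem_subodometer)
      then show ?thesis by blast
    qed
    then show "openin (subodometer_topology G \<Gamma>) ?W"
      unfolding openin_subodometer_iff by blast
  qed
qed

end

section \<open>Subshifts\<close>

context group
begin

lemma topspace_subshift_topology:
  "subshift G \<Sigma> X \<Longrightarrow> topspace (subshift_topology G \<Sigma> X) = X"
  unfolding subshift_def subshift_topology_def
  by (metis closedin_subset topspace_subtopology_subset)

text \<open>Compactness comes from the finite alphabet, metrizability from the countable index set
  \<open>carrier G\<close>.\<close>

lemma dynamical_system_subshift: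
  assumes "countable (carrier G)" "finite \<Sigma>" and X: "subshift G \<Sigma> X"
  shows "dynamical_system G (subshift_topology G \<Sigma> X) (subshift_action G X)"
proof (rule dynamical_systemI)
  have cl: "closedin (full_shift G \<Sigma>) X"
    and inv: "\<And>g x. g \<in> carrier G \<Longrightarrow> x \<in> X \<Longrightarrow> shift G g x \<in> X"
    using X by (auto simp: subshift_def)
  have Xsub: "X \<subseteq> topspace (full_shift G \<Sigma>)" using cl by (rule closedin_subset)
  have "compact_space (full_shift G \<Sigma>)"
    unfolding full_shift_def by (rule compact_space_product_discrete) (rule assms(2))
  then show "compact_space (subshift_topology G \<Sigma> X)"
    unfolding subshift_topology_def by (intro compact_space_subtopology closedin_compact_space cl)
  show "metrizable_space (subshift_topology G \<Sigma> X)"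
    unfolding subshift_topology_def full_shift_def
    by (intro metrizable_space_subtopology metrizable_space_product_discrete assms)
  show "group_action G (topspace (subshift_topology G \<Sigma> X)) (subshift_action G X)"
    unfolding topspace_subshift_topology[OF X]
  proof (rule group_actionI)
    fix x assume x: "x \<in> X"
    then show "subshift_action G X \<one> x = x"
      using shift_one Xsub unfolding subshift_action_def by auto
    fix g h assume "g \<in> carrier G" "h \<in> carrier G"
    then show "subshift_action G X (g \<otimes> h) x = subshift_action G X g (subshift_action G X h x)"
      using x inv by (simp add: subshift_action_def shift_mult)
  qed (simp_all add: subshift_action_def inv)
  fix g assume g: "g \<in> carrier G"
  have "continuous_map (subtopology (full_shift G \<Sigma>) X) (subtopology (full_shift G \<Sigma>) X) (shift G g)"
    unfolding continuous_map_in_subtopology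
    using continuous_map_from_subtopology[OF continuous_map_shift[OF g]] inv[OF g] by auto
  then show "continuous_map (subshift_topology G \<Sigma> X) (subshift_topology G \<Sigma> X) (subshift_action G X g)"
    unfolding subshift_topology_def
    by (rule continuous_map_eq) (simp add: subshift_action_def)
qed

lemma orbit_subshift_action: "x \<in> X \<Longrightarrow> orbit G (subshift_action G X) x = orbit G (shift G) x"
  by (simp add: orbit_def subshift_action_def)

text \<open>One inclusion holds because \<open>X\<close> is closed and invariant. Minimality gives
  density within \<open>X\<close>, and the closure relative to \<open>X\<close> is contained in the
  closure in the full shift.\<close>

lemma minimal_subshift_eq_closure_of_orbit:
  assumes X: "subshift G \<Sigma> X" and min: "minimal_system G (subshift_topology G \<Sigma> X) (subshift_action G X)"
    and x: "x \<in> X"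
  shows "X = full_shift G \<Sigma> closure_of orbit G (shift G) x"
proof -
  have "orbit G (shift G) x \<subseteq> X" using X x by (auto simp: orbit_def subshift_def)
  then have "full_shift G \<Sigma> closure_of orbit G (shift G) x \<subseteq> X"
    using X closure_of_minimal unfolding subshift_def by blast
  moreover have "subshift_topology G \<Sigma> X closure_of orbit G (subshift_action G X) x = X"
    using min x unfolding minimal_system_def topspace_subshift_topology[OF X] by blast
  then have "subshift_topology G \<Sigma> X closure_of orbit G (shift G) x = X"
    unfolding orbit_subshift_action[OF x] .
  then have "X \<subseteq> full_shift G \<Sigma> closure_of orbit G (shift G) x"
    using closure_of_subtopology_subset[of "full_shift G \<Sigma>" X "orbit G (shift G) x"]
    unfolding subshift_topology_def by (elim equalityE) (rule subset_trans)
  ultimately show ?thesis by blast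
qed

end

section \<open>Almost one-to-one extensions of subodometers are Toeplitz\<close>

text \<open>The points of \<open>X\<close> that differ from \<open>x\<close> at \<open>g\<close>
  have a closed image avoiding \<open>\<pi> x\<close>. Some level \<open>n\<close> separates
  \<open>\<pi> x\<close> from this image, and an element fixing coordinate \<open>n\<close> of
  \<open>\<pi> x\<close> moves \<open>x\<close> to a point that must agree with \<open>x\<close> at
  \<open>g\<close>.\<close>

lemma (in subodometer_group) Toeplitz_array_if_unique_preimage:
  assumes X: "subshift G \<Sigma> X"
    and \<pi>: "factor_map G (subshift_topology G \<Sigma> X) (subshift_action G X)
          (subodometer_topology G \<Gamma>) (subodometer_action G \<Gamma>) \<pi>"
    and x: "x \<in> X" and unique: "\<And>z. z \<in> X \<Longrightarrow> \<pi> z = \<pi> x \<Longrightarrow> z = x"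
  shows "Toeplitz_array G \<Sigma> x"
  unfolding Toeplitz_array_def
proof (intro conjI ballI)
  let ?S = "subshift_topology G \<Sigma> X" and ?T = "subodometer_topology G \<Gamma>"
  have inv: "\<And>g x. g \<in> carrier G \<Longrightarrow> x \<in> X \<Longrightarrow> shift G g x \<in> X" using X by (auto simp: subshift_def)
  show x': "x \<in> topspace (full_shift G \<Sigma>)"
    using X x closedin_subset unfolding subshift_def by blast
  have cont: "continuous_map ?S ?T \<pi>" and S: "compact_space ?S" and T: "metrizable_space ?T"
    and img: "\<pi> ` X = subodometer G \<Gamma>"
    and equiv: "\<And>g z. g \<in> carrier G \<Longrightarrow> z \<in> X \<Longrightarrow> \<pi> (shift G g z) = subodometer_action G \<Gamma> g (\<pi> z)"
    using \<pi> topspace_subshift_topology[OF X]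
    unfolding factor_map_def dynamical_system_def topspace_subodometer_topology
    by (auto simp: subshift_action_def)
  have closed: "closed_map ?S ?T \<pi>"
    by (rule continuous_imp_closed_map[OF cont S metrizable_imp_Hausdorff_space[OF T]])
  let ?y = "\<pi> x"
  have y: "?y \<in> subodometer G \<Gamma>" using img x by blast
  fix g assume g: "g \<in> carrier G"
  let ?A = "{z \<in> X. z g \<noteq> x g}"
  have "continuous_map ?S (discrete_topology \<Sigma>) (\<lambda>z. z g)"
    unfolding subshift_topology_def full_shift_def
    by (intro continuous_map_from_subtopology continuous_map_product_projection g)
  moreover have "closedin (discrete_topology \<Sigma>) (\<Sigma> - {x g})" by simp
  ultimately have "closedin ?S {z \<in> topspace ?S. z g \<in> \<Sigma> - {x g}}" by (rule closedin_continuous_map_preimage)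
  moreover have "{z \<in> topspace ?S. z g \<in> \<Sigma> - {x g}} = ?A"
  proof -
    have "z g \<in> \<Sigma>" if "z \<in> X" for z
    proof -
      have "z \<in> topspace (full_shift G \<Sigma>)"
        using X that closedin_subset unfolding subshift_def by blast
      then show ?thesis using g by (auto simp: topspace_full_shift)
    qed
    then show ?thesis unfolding topspace_subshift_topology[OF X] by blast
  qed
  ultimately have "closedin ?S ?A" by simp
  then have "closedin ?T (\<pi> ` ?A)" using closed by (simp add: closed_map_def)
  then have op: "openin ?T (subodometer G \<Gamma> - \<pi> ` ?A)"
    by (simp add: closedin_def topspace_subodometer_topology)
  have "?y \<notin> \<pi> ` ?A"
  proof
    assume "?y \<in> \<pi> ` ?A"
    then obtain z where "z \<in> ?A" "\<pi> z = \<pi> x" by (elim imageE) simp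
    then show False using unique[of z] by blast
  qed
  then have "?y \<in> subodometer G \<Gamma> - \<pi> ` ?A" using y by blast
  then have "\<exists>n. \<forall>z\<in>subodometer G \<Gamma>. z n = ?y n \<longrightarrow> z \<in> subodometer G \<Gamma> - \<pi> ` ?A"
    using op unfolding openin_subodometer_iff by blast
  then obtain n where n: "\<forall>z\<in>subodometer G \<Gamma>. z n = ?y n \<longrightarrow> z \<in> subodometer G \<Gamma> - \<pi> ` ?A" ..
  \<comment> \<open>The stabilizer of a single coset; the index set \<open>{n}\<close> puts it into
    the form of a joint stabilizer.\<close>
  let ?H = "{h \<in> carrier G. \<forall>i\<in>{n}. h <# ?y i = ?y i}"
  have H: "syndetic_subgroup G ?H"
    by (rule syndetic_fixing_lcosets[where H = \<Gamma>]) (use syndetic_seq y in \<open>auto simp: mem_subodometer_iff\<close>)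
  have "x (g \<otimes> h) = x g" if h: "h \<in> ?H" for h
  proof -
    have hG: "h \<in> carrier G" using h by blast
    have hx: "shift G h x \<in> X" using inv[OF hG x] .
    have "\<pi> (shift G h x) n = ?y n"
      using equiv[OF hG x] y h by (simp add: subodometer_action_def)
    moreover have "\<pi> (shift G h x) \<in> subodometer G \<Gamma>" using hx img by blast
    ultimately have "\<pi> (shift G h x) \<notin> \<pi> ` ?A" using n by blast
    then have "shift G h x \<notin> ?A" by blast
    then show ?thesis using hx g by (simp add: shift_apply)
  qed
  then have "g \<in> Per_symbol G x ?H (x g)" using g unfolding Per_symbol_def by blast
  moreover have "x g \<in> \<Sigma>" using x' g by (auto simp: topspace_full_shift)
  ultimately have "g \<in> Per G \<Sigma> x ?H" unfolding Per_def by blast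
  then show "\<exists>H. syndetic_subgroup G H \<and> g \<in> Per G \<Sigma> x H" using H by blast
qed

section \<open>Toeplitz systems are minimal almost one-to-one extensions of subodometers\<close>

text \<open>Recurrence is used with the whole group as both \<open>C\<close> and \<open>N\<close>:
  each pattern of \<open>w\<close> occurs in \<open>x\<close>, hence also along the orbit of any
  \<open>z\<close> in \<open>X\<close>.\<close>

lemma (in group) minimal_Toeplitz_system:
  assumes "countable (carrier G)" "finite \<Sigma>" and X: "subshift G \<Sigma> X"
    and x: "Toeplitz_array G \<Sigma> x" and eq: "X = shift_closure \<Sigma> x (carrier G)"
  shows "minimal_system G (subshift_topology G \<Sigma> X) (subshift_action G X)"
  unfolding minimal_system_def topspace_subshift_topology[OF X]
proof (intro conjI ballI)
  show "dynamical_system G (subshift_topology G \<Sigma> X) (subshift_action G X)"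
    using assms(1-3) by (rule dynamical_system_subshift)
  fix z assume z: "z \<in> X"
  have x': "x \<in> topspace (full_shift G \<Sigma>)" using x by (simp add: Toeplitz_array_def)
  have Xsub: "X \<subseteq> topspace (full_shift G \<Sigma>)" using X closedin_subset unfolding subshift_def by metis
  have orb: "orbit G (shift G) z \<subseteq> X" using X z by (auto simp: orbit_def subshift_def)
  have "X \<subseteq> shift_closure \<Sigma> z (carrier G)"
  proof
    fix w assume w: "w \<in> X"
    have zw: "z \<in> topspace (full_shift G \<Sigma>)" "w \<in> topspace (full_shift G \<Sigma>)"
      using z w Xsub by auto
    have ex: "\<exists>n\<in>carrier G. \<forall>f\<in>F. z (f \<otimes> n) = w f" if F: "finite F" "F \<subseteq> carrier G" for F
    proof -
      obtain c where c: "c \<in> carrier G" "\<forall>f\<in>F. x (f \<otimes> c) = w f"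
        using w F mem_shift_closure_iff[OF x' subset_refl] unfolding eq by meson
      have "\<exists>n\<in>carrier G. \<forall>f\<in>F. z (f \<otimes> n) = x (f \<otimes> c)"
        by (rule Toeplitz_array_recurrent[OF x subset_refl _ _ c(1) F]) (use z eq in auto)
      then show ?thesis using c(2) by simp
    qed
    then show "w \<in> shift_closure \<Sigma> z (carrier G)"
      unfolding mem_shift_closure_iff[OF zw(1) subset_refl] by (intro conjI allI impI zw(2) ex)
  qed
  \<comment> \<open>The orbit lies in \<open>X\<close>; intersecting with \<open>X\<close> prepares
    the formula for closures in a subspace.\<close>
  then have "X \<subseteq> full_shift G \<Sigma> closure_of (X \<inter> orbit G (shift G) z)"
    unfolding shift_closure_carrier using orb by (simp add: Int_absorb1)
  then have "X \<inter> full_shift G \<Sigma> closure_of (X \<inter> orbit G (shift G) z) = X" by (rule Int_absorb2)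
  then show "subshift_topology G \<Sigma> X closure_of orbit G (subshift_action G X) z = X"
    unfolding orbit_subshift_action[OF z] subshift_topology_def closure_of_subtopology .
qed

text \<open>The groups \<open>N n\<close> are auxiliary: they cut the orbit into pieces, while the
  subodometer is built from the possibly larger stabilizers of these pieces.\<close>

locale Toeplitz_periods = group G for G (structure) +
  fixes \<Sigma> :: "'s set" and x :: "'a \<Rightarrow> 's" and N :: "nat \<Rightarrow> 'a set"
  assumes Toeplitz: "Toeplitz_array G \<Sigma> x"
    and normal_N: "\<And>n. N n \<lhd> G"
    and syndetic_N: "\<And>n. syndetic_subgroup G (N n)"
    and N_decreasing: "\<And>n. N (Suc n) \<subseteq> N n"
    and N_period: "\<And>g. g \<in> carrier G \<Longrightarrow> \<exists>n. \<forall>\<gamma>\<in>N n. x (g \<otimes> \<gamma>) = x g"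
begin

text \<open>By recurrence the sets \<open>K n a\<close>, for fixed \<open>n\<close>, are equal or disjoint. They form a finite
  clopen partition of \<open>X\<close> that \<open>G\<close> permutes transitively; \<open>\<Gamma> n\<close> is the stabilizer of \<open>K n \<one>\<close>.\<close>

definition X :: "('a \<Rightarrow> 's) set" where "X = shift_closure \<Sigma> x (carrier G)"

definition K :: "nat \<Rightarrow> 'a \<Rightarrow> ('a \<Rightarrow> 's) set" where "K n a = shift_closure \<Sigma> x (a <# N n)"

definition \<Gamma> :: "nat \<Rightarrow> 'a set" where "\<Gamma> n = {g \<in> carrier G. x \<in> K n g}"

text \<open>All labels \<open>g\<close> of the piece containing \<open>z\<close> are collected, so
  no representative has to be chosen; they form one left coset of \<open>\<Gamma> n\<close>.\<close>

definition \<pi> :: "('a \<Rightarrow> 's) \<Rightarrow> nat \<Rightarrow> 'a set" where "\<pi> z n = {g \<in> carrier G. z \<in> K n g}"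

section \<open>The clopen partition and its stabilizers\<close>

lemma x_in: "x \<in> topspace (full_shift G \<Sigma>)"
  using Toeplitz by (simp add: Toeplitz_array_def)

lemma subgroup_N: "subgroup (N n) G"
  using normal_N by (rule normal_imp_subgroup)

lemma coset_N_subset: "a \<in> carrier G \<Longrightarrow> a <# N n \<subseteq> carrier G"
  by (rule l_coset_subset_G[OF subgroup.subset[OF subgroup_N]])

lemma X_subset: "X \<subseteq> topspace (full_shift G \<Sigma>)"
  unfolding X_def using closedin_shift_closure by (rule closedin_subset)

lemma K_subset_X: "a \<in> carrier G \<Longrightarrow> K n a \<subseteq> X"
  unfolding X_def K_def by (intro shift_closure_mono coset_N_subset)

lemma shift_x_in_K: "a \<in> carrier G \<Longrightarrow> shift G a x \<in> K n a"
  unfolding K_def by (intro self_mem_shift_closure x_in coset_N_subset lcos_self subgroup_N)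

lemma x_in_K: "m \<in> N n \<Longrightarrow> x \<in> K n m"
proof -
  assume m: "m \<in> N n"
  then have mG: "m \<in> carrier G" using subgroup.mem_carrier[OF subgroup_N] by blast
  have "\<one> \<in> m <# N n"
    using m mG by (simp add: mem_l_coset_iff[OF subgroup_N] subgroup.m_inv_closed[OF subgroup_N])
  from self_mem_shift_closure[OF x_in coset_N_subset[OF mG] this] show ?thesis
    by (simp add: K_def shift_one[OF x_in])
qed

lemma shift_in_K:
  assumes "g \<in> carrier G" "a \<in> carrier G" "z \<in> K n a"
  shows "shift G g z \<in> K n (g \<otimes> a)"
  using shift_mem_shift_closure[OF x_in coset_N_subset[OF assms(2)] _ assms(1), of z n] assms
  by (simp add: K_def lcos_m_assoc[OF subgroup.subset[OF subgroup_N]])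

lemma K_eq:
  assumes "a \<in> carrier G" "b \<in> carrier G" "z \<in> K n a" "z \<in> K n b"
  shows "K n a = K n b"
  using shift_closure_cosets_eq[OF Toeplitz normal_N assms(1,2)] assms(3,4) unfolding K_def by blast

lemma X_eq_Union_K: "X = (\<Union>a\<in>carrier G. K n a)"
proof -
  have fin: "finite (lcosets (N n))" using syndetic_N by (simp add: syndetic_subgroup_def)
  have "X = shift_closure \<Sigma> x (\<Union>(lcosets (N n)))"
    unfolding X_def lcosets_part_G[OF subgroup_N] ..
  also have "\<dots> = (\<Union>C\<in>lcosets (N n). shift_closure \<Sigma> x C)" by (rule shift_closure_Union[OF fin])
  finally show ?thesis by (auto simp: LCOSETS_def K_def)
qed

lemma X_cases:
  assumes "z \<in> X"
  obtains a where "a \<in> carrier G" "z \<in> K n a"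
  using assms X_eq_Union_K[of n] by blast

lemma finite_K: "finite (K n ` carrier G)"
proof -
  have "K n ` carrier G \<subseteq> shift_closure \<Sigma> x ` (lcosets (N n))" by (auto simp: LCOSETS_def K_def)
  moreover have "finite (shift_closure \<Sigma> x ` (lcosets (N n)))"
    using syndetic_N by (simp add: syndetic_subgroup_def)
  ultimately show ?thesis by (rule finite_subset)
qed

text \<open>Within \<open>X\<close> the complement of a piece is a finite union of other pieces, all
  of them closed.\<close>

lemma openin_K:
  assumes "a \<in> carrier G"
  shows "openin (subshift_topology G \<Sigma> X) (K n a)"
proof -
  let ?\<C> = "K n ` carrier G - {K n a}"
  have closed: "closedin (full_shift G \<Sigma>) (\<Union>?\<C>)"
    using finite_K by (intro closedin_Union) (auto simp: K_def closedin_shift_closure)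
  have "K n a = (topspace (full_shift G \<Sigma>) - \<Union>?\<C>) \<inter> X"
  proof (intro equalityI subsetI)
    fix z assume z: "z \<in> K n a"
    then have "z \<notin> \<Union>?\<C>" using K_eq[OF assms] by blast
    then show "z \<in> (topspace (full_shift G \<Sigma>) - \<Union>?\<C>) \<inter> X" using z K_subset_X[OF assms] X_subset by blast
  next
    fix z assume z: "z \<in> (topspace (full_shift G \<Sigma>) - \<Union>?\<C>) \<inter> X"
    then obtain b where b: "b \<in> carrier G" "z \<in> K n b" using X_cases[of z n] by blast
    then have "K n b = K n a" using z by blast
    then show "z \<in> K n a" using b(2) by blast
  qed
  then show ?thesis
    unfolding subshift_topology_def openin_subtopology
    using closed by (meson openin_diff openin_topspace)
qed

text \<open>The piece \<open>K n a\<close> contains \<open>shift G a x\<close>, and translating by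
  \<open>inv a\<close> brings that point back to \<open>x\<close>. Equality of two pieces thus
  becomes a condition on \<open>x\<close>, and the pieces are labelled by the left cosets of
  \<open>\<Gamma> n\<close>.\<close>

lemma mem_K_iff:
  assumes a: "a \<in> carrier G" and b: "b \<in> carrier G" and z: "z \<in> K n a"
  shows "z \<in> K n b \<longleftrightarrow> inv a \<otimes> b \<in> \<Gamma> n"
proof
  assume "z \<in> K n b"
  then have "K n a = K n b" using K_eq a b z by blast
  then have "shift G a x \<in> K n b" using shift_x_in_K[OF a, of n] by simp
  then have "shift G (inv a) (shift G a x) \<in> K n (inv a \<otimes> b)" using a b by (intro shift_in_K) auto
  then show "inv a \<otimes> b \<in> \<Gamma> n"
    using a b by (simp add: \<Gamma>_def shift_mult[symmetric] shift_one[OF x_in])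
next
  assume "inv a \<otimes> b \<in> \<Gamma> n"
  then have "shift G a x \<in> K n (a \<otimes> (inv a \<otimes> b))" using a by (intro shift_in_K) (auto simp: \<Gamma>_def)
  then have "shift G a x \<in> K n b" using a b by (simp add: m_assoc[symmetric])
  then have "K n a = K n b" using K_eq[OF a b shift_x_in_K[OF a]] by blast
  then show "z \<in> K n b" using z by blast
qed

lemma N_subset_\<Gamma>: "N n \<subseteq> \<Gamma> n"
  using x_in_K subgroup.mem_carrier[OF subgroup_N] unfolding \<Gamma>_def by blast

text \<open>The closure properties come from comparing labels of the piece containing
  \<open>x\<close>: starting from the label \<open>g\<close>, the test label is
  \<open>g \<otimes> h\<close> for products and \<open>\<one>\<close> for inverses.\<close>

lemma subgroup_\<Gamma>: "subgroup (\<Gamma> n) G"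
proof
  show "\<Gamma> n \<subseteq> carrier G" by (auto simp: \<Gamma>_def)
  show one: "\<one> \<in> \<Gamma> n" using N_subset_\<Gamma> subgroup.one_closed[OF subgroup_N] by blast
  show "g \<otimes> h \<in> \<Gamma> n" if "g \<in> \<Gamma> n" "h \<in> \<Gamma> n" for g h
  proof -
    have gh: "g \<in> carrier G" "h \<in> carrier G" "x \<in> K n g" using that by (auto simp: \<Gamma>_def)
    have "inv g \<otimes> (g \<otimes> h) = h" using gh by (simp add: m_assoc[symmetric])
    then show ?thesis
      using mem_K_iff[OF gh(1) m_closed[OF gh(1,2)] gh(3)] that(2) gh by (simp add: \<Gamma>_def)
  qed
  show "inv g \<in> \<Gamma> n" if "g \<in> \<Gamma> n" for g
  proof -
    have g: "g \<in> carrier G" "x \<in> K n g" using that by (auto simp: \<Gamma>_def)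
    have "x \<in> K n \<one>" using one by (simp add: \<Gamma>_def)
    then show ?thesis using mem_K_iff[OF g(1) one_closed g(2)] g(1) by simp
  qed
qed

section \<open>The factor map onto the subodometer\<close>

lemma K_Suc_subset: "K (Suc n) a \<subseteq> K n a"
  unfolding K_def by (intro shift_closure_mono) (use N_decreasing[of n] in \<open>auto simp: l_coset_def\<close>)

lemma subodometer_sequence_\<Gamma>: "subodometer_sequence G \<Gamma>"
  unfolding subodometer_sequence_def
proof (intro conjI allI)
  show "syndetic_subgroup G (\<Gamma> i)" for i
    by (rule syndetic_mono[OF syndetic_N subgroup_\<Gamma> N_subset_\<Gamma>])
  show "\<Gamma> (Suc i) \<subseteq> \<Gamma> i" for i
    using K_Suc_subset unfolding \<Gamma>_def by blast
qed

sublocale subodometer_group G \<Gamma>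
  by unfold_locales (rule subodometer_sequence_\<Gamma>)

lemma \<pi>_eq_coset:
  assumes "a \<in> carrier G" "z \<in> K n a"
  shows "\<pi> z n = a <# \<Gamma> n"
  using mem_K_iff[OF assms(1) _ assms(2)] mem_l_coset_iff[OF subgroup_\<Gamma> assms(1)]
  unfolding \<pi>_def by blast

lemma \<pi>_eq_coset_iff:
  assumes a: "a \<in> carrier G" and z: "z \<in> X"
  shows "\<pi> z n = a <# \<Gamma> n \<longleftrightarrow> z \<in> K n a"
proof
  assume eq: "\<pi> z n = a <# \<Gamma> n"
  have "a \<in> a <# \<Gamma> n" using a subgroup_\<Gamma> by (rule lcos_self)
  then show "z \<in> K n a" using eq unfolding \<pi>_def by blast
qed (use \<pi>_eq_coset a in blast)

lemma \<pi>_mem_subodometer: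
  assumes z: "z \<in> X"
  shows "\<pi> z \<in> subodometer G \<Gamma>"
  unfolding mem_subodometer_iff
proof (intro conjI allI)
  fix i
  show "\<pi> z i \<in> lcosets (\<Gamma> i)"
    using X_cases[OF z, of i] \<pi>_eq_coset unfolding lcosets_iff by metis
  \<comment> \<open>Since the pieces are nested, one label \<open>a\<close> serves both
    levels.\<close>
  obtain a where a: "a \<in> carrier G" "z \<in> K (Suc i) a" using X_cases[OF z] by blast
  then have "z \<in> K i a" using K_Suc_subset by blast
  then show "coset_projection G \<Gamma> i (\<pi> z (Suc i)) = \<pi> z i"
    using a coset_projection_l_coset[OF is_group subodometer_sequence_\<Gamma> a(1)] by (simp add: \<pi>_eq_coset)
qed

lemma \<pi>_shift_x: "a \<in> carrier G \<Longrightarrow> \<pi> (shift G a x) = (\<lambda>i. a <# \<Gamma> i)"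
  by (rule ext) (rule \<pi>_eq_coset[OF _ shift_x_in_K])

lemma shift_in_X:
  assumes g: "g \<in> carrier G" and z: "z \<in> X"
  shows "shift G g z \<in> X"
proof -
  obtain a where a: "a \<in> carrier G" "z \<in> K 0 a" using z by (rule X_cases)
  then show ?thesis using shift_in_K[OF g a] K_subset_X[OF m_closed[OF g a(1)]] by blast
qed

lemma \<pi>_shift:
  assumes g: "g \<in> carrier G" and z: "z \<in> X"
  shows "\<pi> (shift G g z) = subodometer_action G \<Gamma> g (\<pi> z)"
proof
  fix n
  obtain a where a: "a \<in> carrier G" "z \<in> K n a" using X_cases[OF z] by blast
  have "\<pi> (shift G g z) n = (g \<otimes> a) <# \<Gamma> n" using a g by (intro \<pi>_eq_coset shift_in_K) auto
  also have "\<dots> = g <# \<pi> z n"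
    using a g by (simp add: \<pi>_eq_coset lcos_m_assoc[OF subgroup.subset[OF subgroup_\<Gamma>]])
  also have "\<dots> = subodometer_action G \<Gamma> g (\<pi> z) n"
    using \<pi>_mem_subodometer[OF z] by (simp add: subodometer_action_def)
  finally show "\<pi> (shift G g z) n = subodometer_action G \<Gamma> g (\<pi> z) n" .
qed

lemma subshift_X: "subshift G \<Sigma> X"
  unfolding subshift_def
proof (intro conjI ballI)
  show "closedin (full_shift G \<Sigma>) X" unfolding X_def by (rule closedin_shift_closure)
qed (rule shift_in_X)

text \<open>Coordinate \<open>n\<close> of \<open>\<pi>\<close> is constant on each open piece
  \<open>K n a\<close>.\<close>

lemma continuous_map_\<pi>: "continuous_map (subshift_topology G \<Sigma> X) (subodometer_topology G \<Gamma>) \<pi>"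
  unfolding continuous_map_def topspace_subodometer_topology topspace_subshift_topology[OF subshift_X]
proof (intro conjI allI impI)
  show "\<pi> \<in> X \<rightarrow> subodometer G \<Gamma>" using \<pi>_mem_subodometer by blast
  fix U assume U: "openin (subodometer_topology G \<Gamma>) U"
  show "openin (subshift_topology G \<Sigma> X) {z \<in> X. \<pi> z \<in> U}"
  proof (subst openin_subopen, intro ballI)
    fix z assume z: "z \<in> {z \<in> X. \<pi> z \<in> U}"
    then have "\<exists>n. \<forall>y\<in>subodometer G \<Gamma>. y n = \<pi> z n \<longrightarrow> y \<in> U"
      using U unfolding openin_subodometer_iff by blast
    then obtain n where n: "\<forall>y\<in>subodometer G \<Gamma>. y n = \<pi> z n \<longrightarrow> y \<in> U" ..
    obtain a where a: "a \<in> carrier G" "z \<in> K n a" using X_cases[of z n] z by blast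
    have "K n a \<subseteq> {z \<in> X. \<pi> z \<in> U}"
    proof
      fix w assume w: "w \<in> K n a"
      then have wX: "w \<in> X" using K_subset_X a(1) by blast
      have "\<pi> w n = \<pi> z n" using w a by (simp add: \<pi>_eq_coset)
      then show "w \<in> {z \<in> X. \<pi> z \<in> U}" using n \<pi>_mem_subodometer[OF wX] wX by blast
    qed
    then show "\<exists>T. openin (subshift_topology G \<Sigma> X) T \<and> z \<in> T \<and> T \<subseteq> {z \<in> X. \<pi> z \<in> U}"
      using openin_K[OF a(1)] a(2) by blast
  qed
qed

text \<open>At the position \<open>g\<close> alone, \<open>z\<close> agrees with a translate of
  \<open>x\<close> by an element of the coset \<open>a <# N n\<close>; by periodicity all these
  translates show the same symbol there.\<close>

lemma K_determines_symbol:
  assumes a: "a \<in> carrier G" and z: "z \<in> K n a" and g: "g \<in> carrier G"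
    and per: "\<forall>\<gamma>\<in>N n. x (g \<otimes> a \<otimes> \<gamma>) = x (g \<otimes> a)"
  shows "z g = x (g \<otimes> a)"
proof -
  have "finite {g}" "{g} \<subseteq> carrier G" using g by auto
  then obtain c where c: "c \<in> a <# N n" "\<forall>f\<in>{g}. x (f \<otimes> c) = z f"
    using z mem_shift_closure_iff[OF x_in coset_N_subset[OF a]] unfolding K_def by meson
  obtain \<gamma> where \<gamma>: "\<gamma> \<in> N n" "c = a \<otimes> \<gamma>" using c(1) unfolding l_coset_def by blast
  then have "\<gamma> \<in> carrier G" using subgroup.mem_carrier[OF subgroup_N] by blast
  then have "x (g \<otimes> c) = x (g \<otimes> a)" using per \<gamma> g a by (simp add: m_assoc[symmetric])
  then show ?thesis using c(2) by simp
qed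

lemma almost_1_1_extension_\<pi>:
  assumes "countable (carrier G)" "finite \<Sigma>"
  shows "almost_1_1_extension G (subshift_topology G \<Sigma> X) (subshift_action G X)
    (subodometer_topology G \<Gamma>) (subodometer_action G \<Gamma>)"
proof -
  let ?S = "subshift_topology G \<Sigma> X" and ?T = "subodometer_topology G \<Gamma>"
  have dyn: "dynamical_system G ?S (subshift_action G X)"
    by (rule dynamical_system_subshift[OF assms subshift_X])
  have "closed_map ?S ?T \<pi>"
    using dyn dynamical_system_subodometer continuous_map_\<pi>
    by (intro continuous_imp_closed_map metrizable_imp_Hausdorff_space) (auto simp: dynamical_system_def)
  moreover have "closedin ?S X"
    using closedin_topspace[of ?S] unfolding topspace_subshift_topology[OF subshift_X] .
  ultimately have closed: "closedin ?T (\<pi> ` X)" by (simp add: closed_map_def)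
  \<comment> \<open>Surjectivity: the image is closed, and it is dense because it contains the
    images of the orbit of \<open>x\<close>.\<close>
  have "?T closure_of (\<pi> ` X) = topspace ?T"
  proof (rule closure_of_subodometer_eq)
    show "\<pi> ` X \<subseteq> subodometer G \<Gamma>" using \<pi>_mem_subodometer by blast
    fix a n assume a: "a \<in> carrier G"
    then have "shift G a x \<in> X" using shift_x_in_K K_subset_X by blast
    moreover have "\<pi> (shift G a x) n = a <# \<Gamma> n" using \<pi>_shift_x[OF a] by simp
    ultimately show "\<exists>s\<in>\<pi> ` X. s n = a <# \<Gamma> n" by blast
  qed
  then have surj: "\<pi> ` X = subodometer G \<Gamma>"
    using closed unfolding topspace_subodometer_topology by (simp add: closure_of_closedin)
  have factor: "factor_map G ?S (subshift_action G X) ?T (subodometer_action G \<Gamma>) \<pi>"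
    unfolding factor_map_def topspace_subshift_topology[OF subshift_X] topspace_subodometer_topology
    using dyn dynamical_system_subodometer continuous_map_\<pi> surj
    by (simp add: subshift_action_def \<pi>_shift)

  \<comment> \<open>Over a point of \<open>U g\<close> the symbol at \<open>g\<close> is forced by
    one coordinate \<open>n\<close>. The condition depends on that coordinate, which makes
    \<open>U g\<close> open; countability of the group makes the intersection a
    \<open>G_delta\<close> set.\<close>
  define U where "U g = {y \<in> subodometer G \<Gamma>. \<exists>n s. \<forall>z\<in>X. \<pi> z n = y n \<longrightarrow> z g = s}" for g
  let ?D = "\<Inter>(U ` carrier G)"
  have openU: "openin ?T (U g)" for g
    unfolding openin_subodometer_iff
  proof (intro conjI ballI)
    show "U g \<subseteq> subodometer G \<Gamma>" by (auto simp: U_def)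
    fix y assume "y \<in> U g"
    then obtain n s where "\<forall>z\<in>X. \<pi> z n = y n \<longrightarrow> z g = s" unfolding U_def by blast
    then have "\<forall>z\<in>subodometer G \<Gamma>. z n = y n \<longrightarrow> z \<in> U g"
      unfolding U_def by (intro ballI impI CollectI conjI exI[of _ n] exI[of _ s]) auto
    then show "\<exists>n. \<forall>z\<in>subodometer G \<Gamma>. z n = y n \<longrightarrow> z \<in> U g" ..
  qed
  have gdelta: "gdelta_in ?T ?D"
    using assms(1) openU by (intro gdelta_in_Inter) (auto intro: open_imp_gdelta_in)
  have dense: "?T closure_of ?D = topspace ?T"
  proof (rule closure_of_subodometer_eq)
    show "?D \<subseteq> subodometer G \<Gamma>" using one_closed unfolding U_def by blast
    fix a n assume a: "a \<in> carrier G"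
    \<comment> \<open>These points form the orbit of \<open>\<pi> x\<close>. The level
      \<open>m\<close> is chosen so that \<open>N m\<close> consists of periods at position
      \<open>g \<otimes> a\<close>; it may differ from the level \<open>n\<close> of the density
      test.\<close>
    have "(\<lambda>i. a <# \<Gamma> i) \<in> U g" if g: "g \<in> carrier G" for g
    proof -
      obtain m where m: "\<forall>\<gamma>\<in>N m. x (g \<otimes> a \<otimes> \<gamma>) = x (g \<otimes> a)" using N_period[of "g \<otimes> a"] a g by auto
      have "\<forall>z\<in>X. \<pi> z m = a <# \<Gamma> m \<longrightarrow> z g = x (g \<otimes> a)"
        using K_determines_symbol[OF a _ g m] \<pi>_eq_coset_iff[OF a] by blast
      then show ?thesis using coset_sequence_mem_subodometer[OF a] unfolding U_def by blast
    qed
    then show "\<exists>s\<in>?D. s n = a <# \<Gamma> n" by (intro bexI[of _ "\<lambda>i. a <# \<Gamma> i"]) auto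
  qed
  have unique: "\<exists>!z. z \<in> X \<and> \<pi> z = y" if y: "y \<in> ?D" for y
  proof -
    have "y \<in> \<pi> ` X" unfolding surj using y one_closed unfolding U_def by blast
    then obtain z where z: "z \<in> X" "\<pi> z = y" by (elim imageE) simp
    \<comment> \<open>Two preimages of \<open>y\<close> agree at each \<open>g\<close>, because
      \<open>y\<close> in \<open>U g\<close> forces their common symbol.\<close>
    have "w = z" if w: "w \<in> X" "\<pi> w = y" for w
    proof (rule PiE_ext)
      show "w \<in> (\<Pi>\<^sub>E g\<in>carrier G. \<Sigma>)" "z \<in> (\<Pi>\<^sub>E g\<in>carrier G. \<Sigma>)"
        using w(1) z(1) X_subset unfolding topspace_full_shift by blast+
      fix g assume "g \<in> carrier G"
      then have "y \<in> U g" using y by blast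
      then obtain n s where s: "\<forall>z\<in>X. \<pi> z n = y n \<longrightarrow> z g = s" unfolding U_def by blast
      show "w g = z g"
        using s[rule_format, OF w(1) fun_cong[OF w(2)]] s[rule_format, OF z(1) fun_cong[OF z(2)]] by simp
    qed
    then show ?thesis using z by blast
  qed
  have "?D \<subseteq> {y \<in> topspace ?T. \<exists>!z. z \<in> topspace ?S \<and> \<pi> z = y}"
    unfolding topspace_subshift_topology[OF subshift_X]
    using unique gdelta_in_subset[OF gdelta] by blast
  then show ?thesis
    unfolding almost_1_1_extension_def using factor gdelta dense by blast
qed

end

text \<open>Along an enumeration of the group each position receives a finite-index group of
  periods, shrunk to a normal one. Finite intersections then make the sequence decreasing.\<close>

lemma (in group) Toeplitz_array_imp_Toeplitz_periods:
  assumes "countable (carrier G)" and x: "Toeplitz_array G \<Sigma> x"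
  shows "\<exists>N. Toeplitz_periods G \<Sigma> x N"
proof -
  \<comment> \<open>The enumeration may repeat elements, so finite groups are covered as
    well.\<close>
  define e where "e = from_nat_into (carrier G)"
  have e: "range e = carrier G"
    unfolding e_def using one_closed by (intro range_from_nat_into assms(1)) blast
  have "\<exists>M. syndetic_subgroup G M \<and> M \<lhd> G \<and> (\<forall>\<gamma>\<in>M. x (e m \<otimes> \<gamma>) = x (e m))" for m
  proof -
    have "{e m} \<subseteq> carrier G" using e by blast
    then obtain H where H: "syndetic_subgroup G H" "\<forall>f\<in>{e m}. \<forall>\<gamma>\<in>H. x (f \<otimes> \<gamma>) = x f"
      using Toeplitz_array_periods[OF x, of "{e m}"] by blast
    obtain M where "syndetic_subgroup G M" "M \<lhd> G" "M \<subseteq> H"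
      using H(1) by (rule syndetic_imp_normal_syndetic)
    then show ?thesis using H(2) by blast
  qed
  then obtain M where M: "\<And>m. syndetic_subgroup G (M m)" "\<And>m. M m \<lhd> G"
    "\<And>m. \<forall>\<gamma>\<in>M m. x (e m \<otimes> \<gamma>) = x (e m)" by metis
  \<comment> \<open>\<open>N n\<close> is the intersection of \<open>M 0\<close> up to
    \<open>M n\<close>, hence consists of periods at \<open>e 0\<close> up to
    \<open>e n\<close>.\<close>
  define N where "N = rec_nat (M 0) (\<lambda>n A. A \<inter> M (Suc n))"
  have N0: "N 0 = M 0" and NS: "N (Suc n) = N n \<inter> M (Suc n)" for n by (simp_all add: N_def)
  have NM: "N n \<subseteq> M n" for n by (cases n) (auto simp: N0 NS)
  have "Toeplitz_periods G \<Sigma> x N"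
  proof (intro Toeplitz_periods.intro Toeplitz_periods_axioms.intro is_group)
    show "Toeplitz_array G \<Sigma> x" by (rule x)
    show "N n \<lhd> G" for n
      by (induction n) (auto simp: N0 NS M normal_subgroup_intersect)
    show "syndetic_subgroup G (N n)" for n
      by (induction n) (auto simp: N0 NS M syndetic_Int)
    show "N (Suc n) \<subseteq> N n" for n by (auto simp: NS)
    fix g assume "g \<in> carrier G"
    then obtain m where "g = e m" using e by blast
    then show "\<exists>n. \<forall>\<gamma>\<in>N n. x (g \<otimes> \<gamma>) = x g" using M(3)[of m] NM[of m] by blast
  qed
  then show ?thesis by (rule exI[of _ N])
qed

theorem mainTheorem2:
  fixes G :: "('g, 'm) monoid_scheme"
    and \<Sigma> :: "'s set"
    and X :: "('g \<Rightarrow> 's) set"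
  assumes "group G" and "finitely_generated G"
    and "finite \<Sigma>"
    and "subshift G \<Sigma> X"
  shows "(minimal_system G (subshift_topology G \<Sigma> X) (subshift_action G X) \<and>
          (\<exists>\<Gamma>. subodometer_sequence G \<Gamma> \<and>
             almost_1_1_extension G (subshift_topology G \<Sigma> X) (subshift_action G X)
               (subodometer_topology G \<Gamma>) (subodometer_action G \<Gamma>)))
         \<longleftrightarrow> (\<exists>x. Toeplitz_array G \<Sigma> x \<and>
               X = full_shift G \<Sigma> closure_of orbit G (shift G) x)"
proof
  interpret group G by fact
  {
    assume L: "minimal_system G (subshift_topology G \<Sigma> X) (subshift_action G X) \<and>
          (\<exists>\<Gamma>. subodometer_sequence G \<Gamma> \<and>
             almost_1_1_extension G (subshift_topology G \<Sigma> X) (subshift_action G X)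
               (subodometer_topology G \<Gamma>) (subodometer_action G \<Gamma>))"
    then obtain \<Gamma> \<pi> D where seq: "subodometer_sequence G \<Gamma>"
      and \<pi>: "factor_map G (subshift_topology G \<Sigma> X) (subshift_action G X)
          (subodometer_topology G \<Gamma>) (subodometer_action G \<Gamma>) \<pi>"
      and dense: "subodometer_topology G \<Gamma> closure_of D = topspace (subodometer_topology G \<Gamma>)"
      and D: "D \<subseteq> {y \<in> topspace (subodometer_topology G \<Gamma>).
            \<exists>!x. x \<in> topspace (subshift_topology G \<Sigma> X) \<and> \<pi> x = y}"
      unfolding almost_1_1_extension_def by (elim conjE exE)
    interpret subodometer_group G \<Gamma> by unfold_locales (rule seq)
    \<comment> \<open>The subodometer is nonempty, so its dense subset \<open>D\<close> has a point;
      a single point with a unique preimage already yields the Toeplitz array.\<close>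
    have "(\<lambda>i. \<one>\<^bsub>G\<^esub> <#\<^bsub>G\<^esub> \<Gamma> i) \<in> topspace (subodometer_topology G \<Gamma>)"
      unfolding topspace_subodometer_topology by (intro coset_sequence_mem_subodometer one_closed)
    then have "D \<noteq> {}" using dense by (metis closure_of_empty empty_iff)
    then obtain y where "y \<in> D" by blast
    then have "\<exists>!x. x \<in> X \<and> \<pi> x = y" using D unfolding topspace_subshift_topology[OF assms(4)] by blast
    then obtain x where x: "x \<in> X" "\<pi> x = y" and unique: "\<And>z. z \<in> X \<Longrightarrow> \<pi> z = y \<Longrightarrow> z = x" by blast
    have "Toeplitz_array G \<Sigma> x"
      by (rule Toeplitz_array_if_unique_preimage[OF assms(4) \<pi> x(1)]) (use unique x(2) in blast)
    moreover have "X = full_shift G \<Sigma> closure_of orbit G (shift G) x"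
      using L by (intro minimal_subshift_eq_closure_of_orbit assms(4) x(1)) blast
    ultimately show "\<exists>x. Toeplitz_array G \<Sigma> x \<and> X = full_shift G \<Sigma> closure_of orbit G (shift G) x"
      by blast
  }
  assume "\<exists>x. Toeplitz_array G \<Sigma> x \<and> X = full_shift G \<Sigma> closure_of orbit G (shift G) x"
  then obtain x where x: "Toeplitz_array G \<Sigma> x" and X: "X = shift_closure \<Sigma> x (carrier G)"
    unfolding shift_closure_carrier by (elim exE conjE)
  \<comment> \<open>Finite generation enters through countability of the group.\<close>
  have count: "countable (carrier G)"
    using assms(2) countable_generate countable_finite unfolding finitely_generated_def by metis
  obtain N where "Toeplitz_periods G \<Sigma> x N"
    using Toeplitz_array_imp_Toeplitz_periods[OF count x] ..
  then interpret T: Toeplitz_periods G \<Sigma> x N .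
  have "T.X = X" unfolding T.X_def X ..
  then have "almost_1_1_extension G (subshift_topology G \<Sigma> X) (subshift_action G X)
      (subodometer_topology G T.\<Gamma>) (subodometer_action G T.\<Gamma>)"
    using T.almost_1_1_extension_\<pi>[OF count assms(3)] by simp
  moreover have "minimal_system G (subshift_topology G \<Sigma> X) (subshift_action G X)"
    by (rule minimal_Toeplitz_system[OF count assms(3,4) x X])
  ultimately show "minimal_system G (subshift_topology G \<Sigma> X) (subshift_action G X) \<and>
      (\<exists>\<Gamma>. subodometer_sequence G \<Gamma> \<and>
         almost_1_1_extension G (subshift_topology G \<Sigma> X) (subshift_action G X)
           (subodometer_topology G \<Gamma>) (subodometer_action G \<Gamma>))"
    using T.subodometer_sequence_\<Gamma> by blast
qed

end
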